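(* Let $p\in\mathbb{R}^r$, let $A=(a_{i,j})\in\mathbb{R}^{r\times r}$, set $d=1+2r$, and let $a\le 0<b$. If $f:[a,b]\to\mathbb{R}^r$ is the integral curve of the linear vector field defined by $A$ fulfilling $f(0)=p$, then the path $X:[a,b]\to\mathbb{R}^d$ defined by $X(t)=(t,f(t),f'(t))$ satisfies $$(\ast)\qquad X(0)=(0,p,A\cdot p)\quad\text{and}\quad \sum_{j=1}^r a_{i,j}\langle\sigma(X),(\mathtt{1+j})w\rangle=\langle\sigma(X),(\mathtt{1+r+i})w\rangle$$ for every $i\in\{1,\dots,r\}$ and every word $w\in\mathbb{T}(\mathbb{R}^d)$. Conversely, if a reduced path $X:[a,b]\to\mathbb{R}^d$ is $(r,1)$-holonomic and satisfies $(\ast)$, then the curve $f:[a,b]\to\mathbb{R}^r$ defined by $f(t)=(X_2(t),\dots,X_{r+1}(t))$ is integral with respect to the linear vector field defined by $A$.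
   Context: A curve $\mathbf{x}:[a,b]\to\mathbb{R}^r$ is an integral curve of the linear vector field defined by $A\in\mathbb{R}^{r\times r}$ if $\mathbf{x}'(t)=A\cdot\mathbf{x}(t)$ for every $t\in[a,b]$. Paths. A path $X:[a,b]\to\mathbb{R}^d$ is of class $\mathcal{C}^{1\text{-pw}}$ if it is continuous and there are $a=t_0<t_1<\dots<t_n=b$ such that each restriction $X|_{[t_{i-1},t_i]}$ is of class $\mathcal{C}^1([t_{i-1},t_i])$. The inverse of a path $Y$ on $[a,b]$ is $Y^{-1}(t)=Y(a+b-t)$. A tree-like excursion is a path obtained by concatenating a path $Y$ with $Y^{-1}$. A path is reduced if it contains no tree-like excursion. A path $X:[a,b]\to\mathbb{R}^{1+2r}$ is $(r,1)$-holonomic if it is of class $\mathcal{C}^{1\text{-pw}}$ and $\dot X_i(t)=\dot X_1(t)X_{i+r}(t)$ for all $i\in\{2,\dots,r+1\}$ (at all $t$ for which $\dot X(t)$ exists). Words and signature. $\mathbb{T}(\mathbb{R}^d)$ is the real vector space with basis all words (finite sequences, including the empty word $\varnothing$) in the alphabet $\{\mathtt{1},\dots,\mathtt{d}\}$. Juxtaposition denotes concatenation. $(\mathtt{1+j})$ and $(\mathtt{1+r+i})$ denote single letters, corresponding to the numbers $1+j$ and $1+r+i$. $\langle\sigma(X),\varnothing\rangle=1$ and $$\langle\sigma(X),\mathtt{i}_1\cdots\mathtt{i}_n\rangle=\int_a^b\int_a^{t_n}\cdots\int_a^{t_2}\dot X_{i_1}(t_1)\cdots\dot X_{i_n}(t_n)\,dt_1\cdots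 dt_n,$$ extended linearly to $\mathbb{T}(\mathbb{R}^d)$.
   Formalization: In the converse, f'=Af is shown if X_1(t)=t (it fails for X(t)=(2t,e^{2t},e^{2t}), A=p=1); otherwise, if X' vanishes only finitely often, X_1 is injective and f∘X_1^{-1} is integral on X_1([a,b]). Tree-like excursions are taken up to change of parameter. *)

theory Defs
  imports "HOL-Analysis.Analysis"
begin

definition integral_curve :: "real^'r^'r \<Rightarrow> real set \<Rightarrow> (real \<Rightarrow> real^'r) \<Rightarrow> bool" where
  "integral_curve A S x \<longleftrightarrow> (\<forall>t\<in>S. (x has_vector_derivative (A *v x t)) (at t within S))"

text \<open>The library's \<open>piecewise_C1_differentiable_on\<close> does not ask the derivative to extend
  continuously to the end points of the pieces, so it is not the class used here.\<close>

definition C1_on_interval :: "real \<Rightarrow> real \<Rightarrow> (real \<Rightarrow> 'a::real_normed_vector) \<Rightarrow> bool" where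
  "C1_on_interval c e X \<longleftrightarrow>
     (\<exists>D. (\<forall>t\<in>{c..e}. (X has_vector_derivative D t) (at t within {c..e})) \<and> continuous_on {c..e} D)"

definition C1_pw :: "real \<Rightarrow> real \<Rightarrow> (real \<Rightarrow> 'a::real_normed_vector) \<Rightarrow> bool" where
  "C1_pw a b X \<longleftrightarrow> continuous_on {a..b} X \<and>
     (\<exists>n t. t 0 = a \<and> t n = b \<and>
        (\<forall>i<n. t i < t (Suc i) \<and> C1_on_interval (t i) (t (Suc i)) X))"

text \<open>With parameter interval \<open>[0,1]\<close> the inverse path is \<open>reversepath Y\<close> and concatenation is
  \<open>+++\<close>. An excursion is recognised up to an increasing change of parameter: otherwise
  running along \<open>Y\<close> and then back at a different speed would not count as one.\<close>

definition tree_like_excursion :: "real \<Rightarrow> real \<Rightarrow> (real \<Rightarrow> 'a::topological_space) \<Rightarrow> bool" where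
  "tree_like_excursion s t X \<longleftrightarrow>
     (\<exists>Y \<phi>. path Y \<and> continuous_on {s..t} \<phi> \<and> strict_mono_on {s..t} \<phi> \<and> \<phi> s = 0 \<and> \<phi> t = 1 \<and>
        (\<forall>u\<in>{s..t}. X u = (Y +++ reversepath Y) (\<phi> u)))"

definition reduced :: "real \<Rightarrow> real \<Rightarrow> (real \<Rightarrow> 'a::topological_space) \<Rightarrow> bool" where
  "reduced a b X \<longleftrightarrow> (\<forall>s t. a \<le> s \<and> s < t \<and> t \<le> b \<longrightarrow> \<not> tree_like_excursion s t X)"

text \<open>Words over the alphabet of coordinates are lists; \<open>iter_int\<close> reads its word from the
  last letter (outermost integral) to the first (innermost integral). The derivative may be
  undefined at finitely many points, which does not affect the integral.\<close>

fun iter_int :: "real \<Rightarrow> real \<Rightarrow> (real \<Rightarrow> real^'d) \<Rightarrow> 'd list \<Rightarrow> real \<Rightarrow> real" where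
  "iter_int a b X [] t = 1"
| "iter_int a b X (i # u) t =
     integral {a..t} (\<lambda>s. iter_int a b X u s * vector_derivative X (at s within {a..b}) $ i)"

definition sig :: "real \<Rightarrow> real \<Rightarrow> (real \<Rightarrow> real^'d) \<Rightarrow> 'd list \<Rightarrow> real" where
  "sig a b X w = iter_int a b X (rev w) b"

text \<open>The index type \<open>1 + 'r + 'r\<close> has \<open>1 + 2r\<close> elements, where \<open>r = CARD('r)\<close>:
  \<open>ltime\<close>, \<open>lval j\<close> and \<open>lder i\<close> are the letters \<open>1\<close>, \<open>1+j\<close> and \<open>1+r+i\<close>.\<close>

abbreviation ltime :: "1 + 'r + 'r" where "ltime \<equiv> Inl 1"
abbreviation lval :: "'r \<Rightarrow> 1 + 'r + 'r" where "lval j \<equiv> Inr (Inl j)"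
abbreviation lder :: "'r \<Rightarrow> 1 + 'r + 'r" where "lder i \<equiv> Inr (Inr i)"

definition triple :: "real \<Rightarrow> real^'r \<Rightarrow> real^'r \<Rightarrow> real^(1 + 'r::finite + 'r)" where
  "triple x y z =
     (\<chi> k. case k of Inl _ \<Rightarrow> x | Inr l \<Rightarrow> (case l of Inl j \<Rightarrow> y $ j | Inr i \<Rightarrow> z $ i))"

definition holonomic :: "real \<Rightarrow> real \<Rightarrow> (real \<Rightarrow> real^(1 + 'r::finite + 'r)) \<Rightarrow> bool" where
  "holonomic a b X \<longleftrightarrow> C1_pw a b X \<and>
     (\<forall>t\<in>{a..b}. \<forall>D. (X has_vector_derivative D) (at t within {a..b}) \<longrightarrow>
        (\<forall>i. D $ lval i = D $ ltime * X t $ lder i))"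

definition signature_condition ::
  "real^'r^'r \<Rightarrow> real^'r \<Rightarrow> real \<Rightarrow> real \<Rightarrow> (real \<Rightarrow> real^(1 + 'r::finite + 'r)) \<Rightarrow> bool" where
  "signature_condition A p a b X \<longleftrightarrow>
     X 0 = triple 0 p (A *v p) \<and>
     (\<forall>i w. (\<Sum>j\<in>UNIV. A $ i $ j * sig a b X (lval j # w)) = sig a b X (lder i # w))"

end

theory Submission
  imports Defs
begin

text \<open>Let \<open>c\<^sub>w(u)\<close> be the iterated integral of \<open>X\<close> along the word \<open>w\<close> over \<open>[u,b]\<close>. Integration by
  parts turns the signature identities into \<open>\<integral> g c\<^sub>w dX\<^sub>k = 0\<close> for all \<open>w\<close> and \<open>k\<close>, where \<open>g\<close> is the
  increment from \<open>a\<close> of the defect \<open>\<Sum>\<^sub>j a\<^sub>i\<^sub>j X\<^sub>1\<^sub>+\<^sub>j - X\<^sub>1\<^sub>+\<^sub>r\<^sub>+\<^sub>i\<close>. The span of the functions \<open>c\<^sub>w\<close>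
  is an algebra, so if no other time has the same values \<open>c\<^sub>w\<close> as a regular time \<open>u\<close>, an element of
  this algebra peaking at \<open>u\<close> shows \<open>g(u) = 0\<close>.

  For a reduced path with finitely many irregular times, the \<open>c\<^sub>w\<close> do separate times. Indeed, if
  \<open>s < t\<close> are not separated then \<open>\<integral>\<^sub>s\<^sup>t c\<^sub>w dX\<^sub>k = c\<^sub>k\<^sub>w(s) - c\<^sub>k\<^sub>w(t) = 0\<close>, and the same peak argument with
  \<open>g = 1\<close> gives every regular time in between a partner in \<open>[s,t]\<close>. Passing to ever shorter pairs, one
  arrives at an irregular time around which the path is folded, that is, at a tree-like excursion.

  Hence \<open>g = 0\<close>, and holonomicity gives \<open>f' = \<tau>' A f\<close>, so \<open>f = E \<circ> \<tau>\<close> for the flow line \<open>E\<close> of \<open>A\<close>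
  through \<open>p\<close>. Then \<open>X\<close> and all \<open>c\<^sub>w\<close> are functions of \<open>\<tau>\<close>, and separation makes \<open>\<tau>\<close> injective.\<close>

section \<open>Iterated integrals over final segments of a piecewise C1 path\<close>

text \<open>The letter split off first belongs to the earliest time, so this is the signature
  coefficient of the path on [u,b] with the word in its usual order; \<open>iter_int\<close> instead
  expects the reversed word.\<close>

fun tail_int :: "(real \<Rightarrow> real^'d) \<Rightarrow> real \<Rightarrow> 'd list \<Rightarrow> real \<Rightarrow> real" where
  "tail_int D b [] u = 1"
| "tail_int D b (i # w) u = integral {u..b} (\<lambda>s. tail_int D b w s * D s $ i)"

text \<open>\<open>F\<close> collects the irregular times. It contains the end points, so that the
  regular times form an open set with two-sided derivatives. On \<open>F\<close> itself
  \<open>vector_derivative\<close> may return an arbitrary value, which the integrals do not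
  see.\<close>

locale piecewise_C1_path =
  fixes a b :: real and X :: "real \<Rightarrow> real^'d" and F :: "real set" and D :: "real \<Rightarrow> real^'d"
  defines "D \<equiv> \<lambda>s. vector_derivative X (at s within {a..b})"
  assumes less: "a < b"
    and finite_F: "finite F"
    and ends_F: "a \<in> F" "b \<in> F"
    and continuous_X: "continuous_on {a..b} X"
    and deriv_X: "\<And>u. u \<in> {a..b} - F \<Longrightarrow> (X has_vector_derivative D u) (at u)"
    and continuous_D: "continuous_on ({a..b} - F) D"
    and bounded_D: "bounded (D ` {a..b})"
begin

abbreviation tail :: "'d list \<Rightarrow> real \<Rightarrow> real" where "tail \<equiv> tail_int D b"

text \<open>By Chen's identity, this says that the piece of the path between the two times has
  trivial signature.\<close>

definition indist :: "real \<Rightarrow> real \<Rightarrow> bool" where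
  "indist u v \<longleftrightarrow> (\<forall>w. tail w u = tail w v)"

lemma indist_sym: "indist u v \<Longrightarrow> indist v u"
  and indist_trans: "indist u v \<Longrightarrow> indist v x \<Longrightarrow> indist u x"
  by (auto simp: indist_def)

lemma open_regular: "open ({a..b} - F)"
proof -
  have "{a..b} - F = {a<..<b} - F"
    using ends_F by (auto simp: less_le)
  then show ?thesis
    by (simp add: finite_F finite_imp_closed open_Diff)
qed

lemma regular_interior: "u \<in> {a..b} - F \<Longrightarrow> a < u \<and> u < b"
  using ends_F by (auto simp: less_le)

lemma continuous_at_D: "u \<in> {a..b} - F \<Longrightarrow> isCont D u"
  using continuous_D open_regular continuous_on_eq_continuous_at by blast

lemma bounded_weighted:
  assumes "continuous_on {s..t} g" "a \<le> s" "t \<le> b"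
  obtains B where "B > 0" "\<And>u. u \<in> {s..t} \<Longrightarrow> \<bar>g u * D u $ k\<bar> \<le> B"
proof -
  obtain B1 where B1: "\<And>u. u \<in> {a..b} \<Longrightarrow> norm (D u) \<le> B1"
    using bounded_D unfolding bounded_iff by (metis imageI)
  have "bounded (g ` {s..t})"
    using assms compact_continuous_image compact_imp_bounded by blast
  then obtain B2 where B2: "\<And>u. u \<in> {s..t} \<Longrightarrow> norm (g u) \<le> B2"
    unfolding bounded_iff by (metis imageI)
  have "\<bar>g u * D u $ k\<bar> \<le> \<bar>B2\<bar> * \<bar>B1\<bar> + 1" if "u \<in> {s..t}" for u
  proof -
    have "\<bar>D u $ k\<bar> \<le> \<bar>B1\<bar>"
      using component_le_norm_cart[of "D u" k] B1[of u] that assms by auto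
    moreover have "\<bar>g u\<bar> \<le> \<bar>B2\<bar>" using B2[OF that] by auto
    ultimately have "\<bar>g u\<bar> * \<bar>D u $ k\<bar> \<le> \<bar>B2\<bar> * \<bar>B1\<bar>"
      by (intro mult_mono) auto
    then show ?thesis by (simp add: abs_mult)
  qed
  then show ?thesis
    by (intro that[of "\<bar>B2\<bar> * \<bar>B1\<bar> + 1"]) (auto intro: add_nonneg_pos)
qed

text \<open>\<open>D\<close> may jump at times in \<open>F\<close>; continuity off this finite set
  still gives measurability, and boundedness then gives integrability.\<close>

lemma integrable_weighted:
  assumes "continuous_on {s..t} g" "a \<le> s" "t \<le> b"
  shows "(\<lambda>u. g u * D u $ k) integrable_on {s..t}"
proof -
  obtain B where B: "\<And>u. u \<in> {s..t} \<Longrightarrow> \<bar>g u * D u $ k\<bar> \<le> B"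
    using bounded_weighted[OF assms] by metis
  have fn: "negligible F"
    using finite_F by (simp add: negligible_finite)
  have S: "{s..t} - F \<in> sets lebesgue"
    using negligible_imp_sets[OF fn] by auto
  have "(\<lambda>u. g u * D u $ k) integrable_on ({s..t} - F)"
  proof (rule measurable_bounded_by_integrable_imp_integrable[OF _ _ _ S])
    have "continuous_on ({s..t} - F) D"
      by (rule continuous_on_subset[OF continuous_D]) (use assms in auto)
    moreover have "continuous_on ({s..t} - F) g"
      by (rule continuous_on_subset[OF assms(1)]) auto
    ultimately have "continuous_on ({s..t} - F) (\<lambda>u. g u * D u $ k)"
      by (intro continuous_intros)
    then show "(\<lambda>u. g u * D u $ k) \<in> borel_measurable (lebesgue_on ({s..t} - F))"
      by (rule continuous_imp_measurable_on_sets_lebesgue[OF _ S])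
    show "(\<lambda>u. B) integrable_on ({s..t} - F)"
      by (rule integrable_spike_set[where S="{s..t}"])
         (auto intro: negligible_subset[OF fn])
    show "\<And>x. x \<in> {s..t} - F \<Longrightarrow> norm (g x * D x $ k) \<le> B"
      using B by auto
  qed
  then show ?thesis
    by (rule integrable_spike_set) (auto intro: negligible_subset[OF fn])
qed

lemma deriv_X_nth:
  "u \<in> {a..b} - F \<Longrightarrow> ((\<lambda>u. X u $ k) has_real_derivative D u $ k) (at u)"
  using bounded_linear.has_vector_derivative[OF bounded_linear_vec_nth deriv_X]
  by (simp add: has_real_derivative_iff_has_vector_derivative)

lemma has_integral_deriv:
  assumes "a \<le> s" "s \<le> t" "t \<le> b" "continuous_on {s..t} P"
    and "\<And>u. u \<in> {s<..<t} - F \<Longrightarrow> (P has_real_derivative p u) (at u)"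
  shows "(p has_integral P t - P s) {s..t}"
  using assms
  by (intro fundamental_theorem_of_calculus_interior_strong[OF finite_F])
     (auto simp: has_real_derivative_iff_has_vector_derivative[symmetric])

lemma continuous_at_weighted:
  assumes "continuous_on {a..b} g" "u \<in> {a..b} - F"
  shows "isCont (\<lambda>u. g u * D u $ k) u"
proof -
  have "isCont g u"
    using assms regular_interior[OF assms(2)]
    by (meson continuous_on_eq_continuous_at continuous_on_subset greaterThanLessThan_iff
        greaterThanLessThan_subseteq_atLeastAtMost_iff open_greaterThanLessThan order_refl)
  then show ?thesis
    by (intro continuous_intros continuous_at_D assms)
qed

lemma deriv_initial_integral:
  assumes g: "continuous_on {a..b} g" and u: "u \<in> {a..b} - F"
  shows "((\<lambda>x. integral {a..x} (\<lambda>s. g s * D s $ k)) has_real_derivative g u * D u $ k) (at u)"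
proof -
  have "((\<lambda>x. integral {a..x} (\<lambda>s. g s * D s $ k)) has_vector_derivative g u * D u $ k)
      (at u within ({a..b} - F))"
    by (rule integral_has_vector_derivative_continuous_at
        [OF integrable_weighted[OF g order_refl order_refl] u finite_F])
       (use continuous_at_weighted[OF g u] continuous_at_imp_continuous_at_within in blast)
  then show ?thesis
    using at_within_open[OF u open_regular]
    by (simp add: has_real_derivative_iff_has_vector_derivative)
qed

lemma continuous_initial_integral:
  "continuous_on {a..b} g \<Longrightarrow> continuous_on {a..b} (\<lambda>x. integral {a..x} (\<lambda>s. g s * D s $ k))"
  by (intro indefinite_integral_continuous_1 integrable_weighted) auto

lemma continuous_final_integral:
  "continuous_on {a..b} g \<Longrightarrow> continuous_on {a..b} (\<lambda>x. integral {x..b} (\<lambda>s. g s * D s $ k))"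
  by (intro indefinite_integral_continuous_1' integrable_weighted) auto

lemma deriv_final_integral:
  assumes g: "continuous_on {a..b} g" and u: "u \<in> {a..b} - F"
  shows "((\<lambda>x. integral {x..b} (\<lambda>s. g s * D s $ k)) has_real_derivative - (g u * D u $ k)) (at u)"
proof (rule DERIV_cong[OF has_field_derivative_transform_within_open[OF _ open_regular u]])
  let ?h = "\<lambda>s. g s * D s $ k"
  show "((\<lambda>x. integral {a..b} ?h - integral {a..x} ?h) has_real_derivative 0 - ?h u) (at u)"
    by (intro derivative_intros deriv_initial_integral[OF g u])
  show "integral {a..b} ?h - integral {a..x} ?h = integral {x..b} ?h"
    if "x \<in> {a..b} - F" for x
    using Henstock_Kurzweil_Integration.integral_combine[of a x b ?h]
      integrable_weighted[OF g order_refl order_refl] that by auto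
qed auto

lemma tail_Cons: "tail (k # w) = (\<lambda>x. integral {x..b} (\<lambda>s. tail w s * D s $ k))"
  by (simp add: fun_eq_iff)

lemma continuous_tail: "continuous_on {a..b} (tail w)"
  by (induction w) (auto intro: continuous_final_integral)

lemma deriv_tail:
  "u \<in> {a..b} - F \<Longrightarrow> (tail (k # w) has_real_derivative - (tail w u * D u $ k)) (at u)"
  unfolding tail_Cons by (rule deriv_final_integral[OF continuous_tail])

lemma tail_diff:
  assumes "a \<le> s" "s \<le> t" "t \<le> b"
  shows "((\<lambda>u. tail w u * D u $ k) has_integral tail (k # w) s - tail (k # w) t) {s..t}"
proof -
  have i: "(\<lambda>u. tail w u * D u $ k) integrable_on {s..b}"
    by (rule integrable_weighted) (use assms continuous_on_subset[OF continuous_tail] in auto)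
  have "(\<lambda>u. tail w u * D u $ k) integrable_on {s..t}"
    by (rule integrable_weighted) (use assms continuous_on_subset[OF continuous_tail] in auto)
  then show ?thesis
    using Henstock_Kurzweil_Integration.integral_combine[OF assms(2,3) i]
    by (simp add: has_integral_iff algebra_simps)
qed

lemma tail_letter:
  assumes "u \<in> {a..b}"
  shows "tail [k] u = X b $ k - X u $ k"
proof -
  have "continuous_on {u..b} (\<lambda>u. X u $ k)"
    using assms by (intro continuous_intros continuous_on_subset[OF continuous_X]) auto
  then have "((\<lambda>s. D s $ k) has_integral X b $ k - X u $ k) {u..b}"
    using assms by (intro has_integral_deriv) (auto intro: deriv_X_nth)
  then show ?thesis by (simp add: integral_unique)
qed

text \<open>One-letter words already record the increments of all coordinates up to time
  \<open>b\<close>.\<close>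

lemma indist_imp_eq:
  assumes "u \<in> {a..b}" "v \<in> {a..b}" "indist u v"
  shows "X u = X v"
proof -
  have "X u $ k = X v $ k" for k
    using assms tail_letter[of u k] tail_letter[of v k] unfolding indist_def
    by (metis diff_left_imp_eq)
  then show ?thesis by (simp add: vec_eq_iff)
qed

lemma continuous_iter_int: "continuous_on {a..b} (iter_int a b X w)"
proof (induction w)
  case (Cons i w)
  then show ?case
    using continuous_initial_integral[OF Cons, of i] by (simp add: D_def)
qed auto

lemma iter_int_letter:
  assumes "u \<in> {a..b}"
  shows "iter_int a b X [k] u = X u $ k - X a $ k"
proof -
  have "continuous_on {a..u} (\<lambda>u. X u $ k)"
    using assms by (intro continuous_intros continuous_on_subset[OF continuous_X]) auto
  then have "((\<lambda>s. D s $ k) has_integral X u $ k - X a $ k) {a..u}"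
    using assms by (intro has_integral_deriv) (auto intro: deriv_X_nth)
  then show ?thesis by (simp add: integral_unique D_def)
qed

text \<open>Each letter of \<open>w\<close> is moved from the outer to the inner integral by an integration by parts.\<close>

lemma integral_iter_int_tail:
  "integral {a..b} (\<lambda>u. iter_int a b X v u * tail w u * D u $ i) =
    iter_int a b X (rev w @ i # v) b"
proof (induction w arbitrary: v i)
  case Nil
  then show ?case by (simp add: D_def)
next
  case (Cons j w)
  let ?I = "iter_int a b X v" and ?J = "iter_int a b X (i # v)"
  have J: "?J = (\<lambda>x. integral {a..x} (\<lambda>s. ?I s * D s $ i))"
    by (simp add: D_def fun_eq_iff)
  have cI: "continuous_on {a..b} (\<lambda>u. ?I u * tail (j # w) u)"
    by (intro continuous_intros continuous_iter_int continuous_tail)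
  have cJ: "continuous_on {a..b} (\<lambda>u. ?J u * tail w u)"
    by (intro continuous_on_mult continuous_iter_int continuous_tail)
  have "((\<lambda>u. ?I u * D u $ i * tail (j # w) u - ?J u * (tail w u * D u $ j)) has_integral
      ?J b * tail (j # w) b - ?J a * tail (j # w) a) {a..b}"
  proof (rule has_integral_deriv)
    show "continuous_on {a..b} (\<lambda>u. ?J u * tail (j # w) u)"
      by (intro continuous_on_mult continuous_iter_int continuous_tail)
    fix u assume u: "u \<in> {a<..<b} - F"
    have "((\<lambda>u. ?J u) has_real_derivative ?I u * D u $ i) (at u)"
      unfolding J by (rule deriv_initial_integral) (use u continuous_iter_int in auto)
    moreover have "(tail (j # w) has_real_derivative - (tail w u * D u $ j)) (at u)"
      using deriv_tail[of u] u by auto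
    ultimately show "((\<lambda>u. ?J u * tail (j # w) u) has_real_derivative
        ?I u * D u $ i * tail (j # w) u - ?J u * (tail w u * D u $ j)) (at u)"
      by (auto intro!: derivative_eq_intros simp del: iter_int.simps tail_int.simps)
  qed (use less in auto)
  \<comment> \<open>The boundary terms vanish because \<open>?J a\<close> and
    \<open>tail (j # w) b\<close> are integrals over a single point.\<close>
  then have "integral {a..b} (\<lambda>u. (?I u * tail (j # w) u) * D u $ i - (?J u * tail w u) * D u $ j) = 0"
    by (simp add: has_integral_iff mult_ac)
  then have "integral {a..b} (\<lambda>u. (?I u * tail (j # w) u) * D u $ i) =
      integral {a..b} (\<lambda>u. (?J u * tail w u) * D u $ j)"
    using integral_diff[OF integrable_weighted[OF cI order_refl order_refl]
        integrable_weighted[OF cJ order_refl order_refl], of i j]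
    by (simp del: iter_int.simps tail_int.simps)
  then show ?case
    using Cons[of "i # v" j] by (simp del: iter_int.simps tail_int.simps)
qed

text \<open>The first letter is kept as a factor, where it integrates to a coordinate increment, and
  the later letters go into \<open>tail w\<close>. In this form a linear relation between
  coefficients that differ only in the first letter is tested against all functions
  \<open>tail w\<close>.\<close>

lemma sig_eq_integral:
  "sig a b X (l # i # w) = integral {a..b} (\<lambda>u. (X u $ l - X a $ l) * tail w u * D u $ i)"
proof -
  have "sig a b X (l # i # w) = integral {a..b} (\<lambda>u. iter_int a b X [l] u * tail w u * D u $ i)"
    using integral_iter_int_tail[of "[l]" w i] by (simp add: sig_def del: iter_int.simps tail_int.simps)
  also have "\<dots> = integral {a..b} (\<lambda>u. (X u $ l - X a $ l) * tail w u * D u $ i)"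
    by (intro integral_cong) (simp only: iter_int_letter)
  finally show ?thesis .
qed

end

section \<open>Concentration of integrals at a peak\<close>

text \<open>Laplace's method: with \<open>r < r' < 1\<close>, a window around \<open>x\<close>
  contributes at least a constant times \<open>r' ^ n\<close>, while negative contributions come
  only from where \<open>p\<close> is at most \<open>r\<close> and are of order
  \<open>r ^ n\<close>. For large \<open>n\<close> the window wins.\<close>

lemma peak_integral_pos:
  fixes q p :: "real \<Rightarrow> real"
  assumes x: "s < x" "x < t" and q: "isCont q x" "q x > 0" and p: "isCont p x" "p x = 1"
    and B: "\<And>u. u \<in> {s..t} \<Longrightarrow> \<bar>q u\<bar> \<le> B"
    and p01: "\<And>u. u \<in> {s..t} \<Longrightarrow> 0 \<le> p u" "\<And>u. u \<in> {s..t} \<Longrightarrow> p u \<le> 1"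
    and near: "\<And>u. u \<in> {s..t} \<Longrightarrow> \<bar>u - x\<bar> < d \<Longrightarrow> 0 \<le> q u"
    and far: "\<And>u. u \<in> {s..t} \<Longrightarrow> d \<le> \<bar>u - x\<bar> \<Longrightarrow> p u \<le> r"
    and r: "0 < r" "r < 1"
  shows "\<exists>n. \<not> ((\<lambda>u. q u * p u ^ n) has_integral 0) {s..t}"
proof (rule ccontr)
  assume "\<not> ?thesis"
  then have int0: "((\<lambda>u. q u * p u ^ n) has_integral 0) {s..t}" for n
    by blast
  define m where "m = q x / 2"
  define r' where "r' = (1 + r) / 2"
  have m: "m > 0" "m < q x" and r': "r < r'" "r' < 1"
    using q r by (auto simp: m_def r'_def)
  have "eventually (\<lambda>u. m < q u \<and> r' < p u) (nhds x)"
    using q p m r' unfolding isCont_def tendsto_at_iff_tendsto_nhds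
    by (intro eventually_conj order_tendstoD(1)) auto
  then obtain e0 where e0: "e0 > 0" "\<And>u. dist u x < e0 \<Longrightarrow> m < q u \<and> r' < p u"
    unfolding eventually_nhds_metric by blast
  \<comment> \<open>Halving \<open>e0\<close> puts the closed window inside the open ball; the other
    bounds keep it inside \<open>{s..t}\<close>.\<close>
  define e where "e = min (e0 / 2) (min (x - s) (t - x))"
  have e: "e > 0" "e < e0" "e \<le> x - s" "e \<le> t - x"
    using e0 x by (auto simp: e_def)
  have B0: "0 \<le> B"
    using B[of x] x by auto
  have bound: "2 * e * m * r' ^ n \<le> B * (t - s) * r ^ n" for n
  proof -
    \<comment> \<open>This step function, lowered by the constant \<open>B * r ^ n\<close>, is a
      minorant of the integrand on all of \<open>{s..t}\<close>.\<close>
    let ?f = "\<lambda>u. if u \<in> {x - e..x + e} then m * r' ^ n else 0"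
    have "((\<lambda>u. m * r' ^ n) has_integral 2 * e * (m * r' ^ n)) {x - e..x + e}"
      using has_integral_const_real[of "m * r' ^ n" "x - e" "x + e"] e by simp
    then have "(?f has_integral 2 * e * (m * r' ^ n)) {s..t}"
      using e by (subst has_integral_restrict) auto
    moreover have "((\<lambda>u. B * r ^ n) has_integral (t - s) * (B * r ^ n)) {s..t}"
      using has_integral_const_real[of "B * r ^ n" s t] x by simp
    ultimately have lower: "((\<lambda>u. ?f u - B * r ^ n) has_integral
        2 * e * (m * r' ^ n) - (t - s) * (B * r ^ n)) {s..t}"
      by (rule has_integral_diff)
    have "2 * e * (m * r' ^ n) - (t - s) * (B * r ^ n) \<le> 0"
    proof (rule has_integral_le[OF lower int0[of n]])
      fix u assume u: "u \<in> {s..t}"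
      have Br: "0 \<le> B * r ^ n" using B0 r by simp
      show "?f u - B * r ^ n \<le> q u * p u ^ n"
      proof (cases "u \<in> {x - e..x + e}")
        case True
        then have "m < q u" "r' < p u"
          using e0(2)[of u] e by (auto simp: dist_real_def)
        then have "m * r' ^ n \<le> q u * p u ^ n"
          using m r r' by (intro mult_mono power_mono) auto
        then show ?thesis using Br True by simp
      next
        case out: False
        have "- (B * r ^ n) \<le> q u * p u ^ n"
        proof (cases "\<bar>u - x\<bar> < d")
          case True
          then have "0 \<le> q u * p u ^ n"
            using near[OF u] p01(1)[OF u] by simp
          then show ?thesis using Br by linarith
        next
          case False
          then have "\<bar>q u * p u ^ n\<bar> \<le> B * r ^ n"
            unfolding abs_mult power_abs[symmetric]
            using B[OF u] far[OF u] p01(1)[OF u] B0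
            by (intro mult_mono) (auto intro: power_mono)
          then show ?thesis by linarith
        qed
        with out show ?thesis by auto
      qed
    qed
    then show ?thesis by (simp add: mult_ac)
  qed
  have "1 < r' / r" using r r' by simp
  then obtain n where n: "B * (t - s) / (2 * e * m) < (r' / r) ^ n"
    using real_arch_pow by blast
  have "B * (t - s) * r ^ n < 2 * e * m * r' ^ n"
    using n e m r by (simp add: power_divide field_simps)
  with bound[of n] show False by linarith
qed

text \<open>Multiplying by the constant \<open>q x\<close> makes the value at the peak a square,
  which reduces everything to the positive case.\<close>

lemma peak_integral_nonzero:
  fixes q p :: "real \<Rightarrow> real"
  assumes x: "s < x" "x < t" and q: "isCont q x" "q x \<noteq> 0" and p: "isCont p x" "p x = 1"
    and B: "\<And>u. u \<in> {s..t} \<Longrightarrow> \<bar>q u\<bar> \<le> B"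
    and p01: "\<And>u. u \<in> {s..t} \<Longrightarrow> 0 \<le> p u" "\<And>u. u \<in> {s..t} \<Longrightarrow> p u \<le> 1"
    and near: "\<And>u. u \<in> {s..t} \<Longrightarrow> \<bar>u - x\<bar> < d \<Longrightarrow> 0 \<le> q u * q x"
    and far: "\<And>u. u \<in> {s..t} \<Longrightarrow> d \<le> \<bar>u - x\<bar> \<Longrightarrow> p u \<le> r"
    and r: "0 < r" "r < 1"
  shows "\<exists>n. \<not> ((\<lambda>u. q u * p u ^ n) has_integral 0) {s..t}"
proof -
  have "\<exists>n. \<not> ((\<lambda>u. q u * q x * p u ^ n) has_integral 0) {s..t}"
  proof (rule peak_integral_pos[where B = "B * \<bar>q x\<bar>" and q = "\<lambda>u. q u * q x", OF x _ _ p _ p01 near far r])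
    show "0 < q x * q x" using q by (simp add: zero_less_mult_iff) linarith
    show "\<And>u. u \<in> {s..t} \<Longrightarrow> \<bar>q u * q x\<bar> \<le> B * \<bar>q x\<bar>"
      using B by (simp add: abs_mult mult_right_mono)
  qed (use q in auto)
  then obtain n where n: "\<not> ((\<lambda>u. q u * q x * p u ^ n) has_integral 0) {s..t}" ..
  have "((\<lambda>u. q u * q x * p u ^ n) has_integral 0) {s..t}"
    if "((\<lambda>u. q u * p u ^ n) has_integral 0) {s..t}"
    using has_integral_mult_right[OF that, of "q x"] by (simp add: mult_ac)
  with n show ?thesis by blast
qed

section \<open>The algebra spanned by the tail functions\<close>

context piecewise_C1_path
begin

text \<open>The condition on \<open>h\<close> concerns only times in \<open>{a..b}\<close>, so
  functions agreeing there count as the same. Closure under products needs this freedom, since the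
  shuffle identity is proved only on that interval.\<close>

inductive_set tails :: "(real \<Rightarrow> real) set" where
  word: "tail w \<in> tails"
| lincomb: "f \<in> tails \<Longrightarrow> g \<in> tails \<Longrightarrow> (\<And>u. u \<in> {a..b} \<Longrightarrow> h u = \<alpha> * f u + \<beta> * g u) \<Longrightarrow> h \<in> tails"

lemma continuous_tails: "h \<in> tails \<Longrightarrow> continuous_on {a..b} h"
proof (induction rule: tails.induct)
  case (lincomb f g h \<alpha> \<beta>)
  then have "continuous_on {a..b} (\<lambda>u. \<alpha> * f u + \<beta> * g u)"
    by (intro continuous_intros)
  then show ?case
    using lincomb.hyps(3) continuous_on_cong by (metis (no_types, lifting))
qed (rule continuous_tail)

lemma tails_const: "(\<lambda>u. c) \<in> tails"
  by (rule lincomb[OF word[of "[]"] word[of "[]"], of _ c 0]) simp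

lemma tails_final_integral:
  "h \<in> tails \<Longrightarrow> (\<lambda>x. integral {x..b} (\<lambda>s. h s * D s $ k)) \<in> tails"
proof (induction rule: tails.induct)
  case (word w)
  then show ?case
    using tails.word[of "k # w"] by (simp add: tail_Cons)
next
  case (lincomb f g h \<alpha> \<beta>)
  show ?case
  proof (rule tails.lincomb[OF lincomb.IH])
    fix u assume u: "u \<in> {a..b}"
    have int: "(\<lambda>s. f s * D s $ k) integrable_on {u..b}" "(\<lambda>s. g s * D s $ k) integrable_on {u..b}"
      using lincomb.hyps(1,2)[THEN continuous_tails] u
      by (auto intro!: integrable_weighted elim: continuous_on_subset)
    have "integral {u..b} (\<lambda>s. h s * D s $ k) =
        integral {u..b} (\<lambda>s. \<alpha> * (f s * D s $ k) + \<beta> * (g s * D s $ k))"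
      using u by (intro integral_cong) (simp add: lincomb.hyps(3) algebra_simps)
    also have "\<dots> = \<alpha> * integral {u..b} (\<lambda>s. f s * D s $ k) + \<beta> * integral {u..b} (\<lambda>s. g s * D s $ k)"
      by (subst integral_add) (auto intro!: integrable_on_mult_right int)
    finally show "integral {u..b} (\<lambda>s. h s * D s $ k) =
        \<alpha> * integral {u..b} (\<lambda>s. f s * D s $ k) + \<beta> * integral {u..b} (\<lambda>s. g s * D s $ k)" .
  qed
qed

text \<open>The shuffle product identity, in recursive form.\<close>

lemma tails_mult_word: "(\<lambda>u. tail v u * tail w u) \<in> tails"
proof (induction v arbitrary: w)
  case Nil
  then show ?case by (simp add: tails.word)
next
  case outer: (Cons i v)
  show ?case
  proof (induction w)
    case Nil
    then show ?case using tails.word[of "i # v"] by (simp add: tail_Cons)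
  next
    case (Cons j w)
    let ?f = "\<lambda>u. tail v u * tail (j # w) u" and ?g = "\<lambda>u. tail (i # v) u * tail w u"
    have fg: "?f \<in> tails" "?g \<in> tails"
      using outer[of "j # w"] Cons by auto
    show ?case
    proof (rule tails.lincomb[OF fg[THEN tails_final_integral], of _ 1 i 1 j])
      fix u assume u: "u \<in> {a..b}"
      have cont: "continuous_on {u..b} h" if "h \<in> tails" for h
        using that u by (auto elim: continuous_on_subset[OF continuous_tails])
      let ?P = "\<lambda>u. tail (i # v) u * tail (j # w) u"
      \<comment> \<open>By the product rule the derivative falls on either factor and strips the
        first letter of its word. As the product vanishes at \<open>b\<close>, integrating back
        yields the two shuffle terms.\<close>
      have neg: "((\<lambda>u. - (?f u * D u $ i) - ?g u * D u $ j) has_integral ?P b - ?P u) {u..b}"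
      proof (rule has_integral_deriv)
        show "continuous_on {u..b} ?P"
          by (intro continuous_on_mult cont tails.word)
        fix x assume "x \<in> {u<..<b} - F"
        then have x: "x \<in> {a..b} - F" using u by auto
        show "(?P has_real_derivative - (?f x * D x $ i) - ?g x * D x $ j) (at x)"
          by (rule derivative_eq_intros deriv_tail[OF x] refl)+ (simp add: algebra_simps)
      qed (use u in auto)
      have eq: "(\<lambda>u. - (- (?f u * D u $ i) - ?g u * D u $ j)) =
          (\<lambda>u. ?f u * D u $ i + ?g u * D u $ j)"
        by (simp add: fun_eq_iff del: tail_int.simps)
      have Pb: "?P b = 0" by simp
      have "integral {u..b} (\<lambda>u. ?f u * D u $ i + ?g u * D u $ j) = ?P u"
        using has_integral_neg[OF neg] unfolding eq Pb
        by (simp add: has_integral_iff del: tail_int.simps)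
      moreover have "integral {u..b} (\<lambda>u. ?f u * D u $ i + ?g u * D u $ j) =
          integral {u..b} (\<lambda>u. ?f u * D u $ i) + integral {u..b} (\<lambda>u. ?g u * D u $ j)"
        using u by (intro integral_add integrable_weighted cont fg) auto
      ultimately show "?P u = 1 * integral {u..b} (\<lambda>u. ?f u * D u $ i) + 1 * integral {u..b} (\<lambda>u. ?g u * D u $ j)"
        by simp
    qed
  qed
qed

lemma tails_mult:
  assumes "f \<in> tails" "g \<in> tails"
  shows "(\<lambda>u. f u * g u) \<in> tails"
  using assms(1)
proof (induction rule: tails.induct)
  case (word v)
  show ?case
    using assms(2)
  proof (induction rule: tails.induct)
    case (lincomb f g h \<alpha> \<beta>)
    show ?case
      by (rule tails.lincomb[OF lincomb.IH, of _ \<alpha> \<beta>]) (simp add: lincomb.hyps(3) algebra_simps)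
  qed (rule tails_mult_word)
next
  case (lincomb f g h \<alpha> \<beta>)
  show ?case
    by (rule tails.lincomb[OF lincomb.IH, of _ \<alpha> \<beta>]) (simp add: lincomb.hyps(3) algebra_simps)
qed

lemma tails_power: "f \<in> tails \<Longrightarrow> (\<lambda>u. f u ^ n) \<in> tails"
  by (induction n) (auto intro: tails_const tails_mult)

lemma tails_lincomb: "f \<in> tails \<Longrightarrow> g \<in> tails \<Longrightarrow> (\<lambda>u. \<alpha> * f u + \<beta> * g u) \<in> tails"
  by (rule lincomb[of f g _ \<alpha> \<beta>]) auto

lemma tails_sum: "(\<And>i. i \<in> I \<Longrightarrow> f i \<in> tails) \<Longrightarrow> (\<lambda>u. \<Sum>i\<in>I. f i u) \<in> tails"
proof (induction I rule: infinite_finite_induct)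
  case (insert i I)
  then show ?case
    using tails_lincomb[of "f i" "\<lambda>u. \<Sum>i\<in>I. f i u" 1 1] by auto
qed (auto intro: tails_const)

text \<open>Linearity extends the vanishing from words to the whole algebra, in particular to the
  powers of a peaking function.\<close>

lemma tails_annihilated:
  assumes g: "\<And>w. ((\<lambda>u. g u * tail w u * D u $ k) has_integral 0) {s..t}"
    and "h \<in> tails" "a \<le> s" "t \<le> b"
  shows "((\<lambda>u. g u * h u * D u $ k) has_integral 0) {s..t}"
  using assms(2)
proof (induction rule: tails.induct)
  case (lincomb f f' h \<alpha> \<beta>)
  have "((\<lambda>u. \<alpha> * (g u * f u * D u $ k) + \<beta> * (g u * f' u * D u $ k)) has_integral \<alpha> * 0 + \<beta> * 0) {s..t}"
    by (intro has_integral_add has_integral_mult_right lincomb.IH)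
  then show ?case
    using assms(3,4) by (auto elim!: has_integral_eq[rotated] simp: lincomb.hyps(3) algebra_simps)
qed (rule g)

text \<open>As in the Stone-Weierstrass theorem: for each \<open>v\<close> in \<open>K\<close> some
  word has a squared difference from its value at \<open>x\<close> that is positive near
  \<open>v\<close>. By compactness finitely many such squares cover \<open>K\<close>, and their sum
  cannot cancel.\<close>

lemma tails_separate:
  assumes "K \<subseteq> {a..b}" "compact K" "\<And>v. v \<in> K \<Longrightarrow> \<not> indist x v"
  obtains h where "h \<in> tails" "h x = 0" "\<And>u. 0 \<le> h u" "\<And>v. v \<in> K \<Longrightarrow> 0 < h v"
proof -
  define q where "q w u = (tail w u - tail w x)\<^sup>2" for w u
  have q: "q w \<in> tails" for w
    unfolding q_def using tails_power[OF tails_lincomb[OF tails.word tails_const[of 1], of 1 w "- tail w x"], of 2]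
    by simp
  have "\<exists>w e. e > 0 \<and> (\<forall>u\<in>K. dist u v < e \<longrightarrow> 0 < q w u)" if v: "v \<in> K" for v
  proof -
    obtain w where "tail w x \<noteq> tail w v"
      using assms(3)[OF v] by (auto simp: indist_def)
    then have "0 < q w v" by (simp add: q_def)
    moreover have "continuous_on K (q w)"
      using continuous_tails[OF q] assms(1) continuous_on_subset by blast
    ultimately obtain e where "e > 0" "\<And>u. u \<in> K \<Longrightarrow> dist u v < e \<Longrightarrow> dist (q w u) (q w v) < q w v"
      using v unfolding continuous_on_iff by meson
    moreover have "dist (q w u) (q w v) < q w v \<Longrightarrow> 0 < q w u" for u
      by (simp add: dist_real_def)
    ultimately show ?thesis by blast
  qed
  then obtain W e where We: "\<And>v. v \<in> K \<Longrightarrow> e v > 0"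
      "\<And>v u. v \<in> K \<Longrightarrow> u \<in> K \<Longrightarrow> dist u v < e v \<Longrightarrow> 0 < q (W v) u"
    by metis
  have "K \<subseteq> (\<Union>v\<in>K. ball v (e v))" using We(1) by force
  then obtain C where C: "C \<subseteq> K" "finite C" "K \<subseteq> (\<Union>v\<in>C. ball v (e v))"
    using compactE_image[OF assms(2), of K "\<lambda>v. ball v (e v)"] by auto
  show ?thesis
  proof (rule that[of "\<lambda>u. \<Sum>v\<in>C. q (W v) u"])
    show "(\<lambda>u. \<Sum>v\<in>C. q (W v) u) \<in> tails"
      by (intro tails_sum q)
    show "(\<Sum>v\<in>C. q (W v) x) = 0" "\<And>u. 0 \<le> (\<Sum>v\<in>C. q (W v) u)"
      by (auto simp: q_def intro: sum_nonneg)
    fix u assume u: "u \<in> K"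
    then obtain v where v: "v \<in> C" "dist v u < e v" using C by auto
    have "0 < q (W v) u"
      using We(2)[of v u] v u C by (auto simp: dist_commute)
    also have "\<dots> \<le> (\<Sum>v\<in>C. q (W v) u)"
      using C v by (intro member_le_sum) (auto simp: q_def)
    finally show "0 < (\<Sum>v\<in>C. q (W v) u)" .
  qed
qed

text \<open>If no other point were indistinguishable from \<open>x\<close>, some element \<open>p\<close> of the algebra would
  peak exactly at \<open>x\<close>, and the powers of \<open>p\<close> would concentrate the integral there.\<close>

lemma exists_indist:
  assumes st: "a \<le> s" "t \<le> b" and x: "x \<in> {s<..<t} - F" and Dx: "D x \<noteq> 0"
    and g: "continuous_on {a..b} g" "g x \<noteq> 0"
    and int0: "\<And>w k. ((\<lambda>u. g u * tail w u * D u $ k) has_integral 0) {s..t}"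
  shows "\<exists>v\<in>{s..t}. v \<noteq> x \<and> indist x v"
proof (rule ccontr)
  assume contra: "\<not> ?thesis"
  have xr: "x \<in> {a..b} - F" using x st by auto
  obtain k where k: "D x $ k \<noteq> 0" using Dx by (auto simp: vec_eq_iff)
  define q where "q u = g u * D u $ k" for u
  have qx: "q x \<noteq> 0" and qc: "isCont q x"
    using k g(2) continuous_at_weighted[OF g(1) xr] by (auto simp: q_def[abs_def])
  have "eventually (\<lambda>u. dist (q u) (q x) < \<bar>q x\<bar>) (nhds x)"
    using qx qc unfolding isCont_def tendsto_at_iff_tendsto_nhds by (intro tendstoD) auto
  then obtain d0 where d0: "d0 > 0" "\<And>u. dist u x < d0 \<Longrightarrow> dist (q u) (q x) < \<bar>q x\<bar>"
    unfolding eventually_nhds_metric by blast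
  \<comment> \<open>Within distance \<open>d\<close> of \<open>x\<close> the function
    \<open>q\<close> keeps the sign of \<open>q x\<close>, and the window does not leave
    \<open>{s..t}\<close>.\<close>
  define d where "d = min d0 (min (x - s) (t - x))"
  have d: "d > 0" "d \<le> d0" "d \<le> x - s" "d \<le> t - x" using d0 x by (auto simp: d_def)
  define K where "K = {s..x - d} \<union> {x + d..t}"
  have K: "K \<subseteq> {s..t}" "compact K" "K \<noteq> {}" "x \<notin> K"
    using d by (auto simp: K_def)
  have Kab: "K \<subseteq> {a..b}"
    using K(1) st by auto
  have unique: "\<not> indist x v" if "v \<in> K" for v
    using contra K that by (metis subsetD)
  obtain h where h: "h \<in> tails" "h x = 0" "\<And>u. 0 \<le> h u" "\<And>v. v \<in> K \<Longrightarrow> 0 < h v"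
    using tails_separate[OF _ K(2) unique] Kab by blast
  have hc: "continuous_on {s..t} h" "continuous_on K h"
    using continuous_tails[OF h(1)] K st by (auto elim!: continuous_on_subset)
  obtain v0 where v0: "v0 \<in> K" "\<And>v. v \<in> K \<Longrightarrow> h v0 \<le> h v"
    using continuous_attains_inf[OF K(2,3) hc(2)] by blast
  obtain v1 where v1: "v1 \<in> {s..t}" "\<And>v. v \<in> {s..t} \<Longrightarrow> h v \<le> h v1"
    using continuous_attains_sup[OF compact_Icc _ hc(1)] x by auto
  \<comment> \<open>Twice the maximum of \<open>h\<close>: then \<open>1 - h u / M\<close> lies
    between 1/2 and 1, so the bound \<open>1 - h v0 / M\<close> away from \<open>x\<close> is
    positive as well as less than 1.\<close>
  define M where "M = 2 * h v1"
  have M: "M > 0" "\<And>v. v \<in> {s..t} \<Longrightarrow> h v \<le> M" "h v0 < M"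
    using v1 v0 h K unfolding M_def by (smt (verit) subset_iff)+
  define p where "p u = 1 + (- 1 / M) * h u" for u
  have p: "p \<in> tails"
    using tails_lincomb[OF tails_const[of 1] h(1), of 1 "- 1 / M"] by (simp add: p_def[abs_def])
  obtain B where B: "\<And>u. u \<in> {s..t} \<Longrightarrow> \<bar>q u\<bar> \<le> B"
    using bounded_weighted[OF continuous_on_subset[OF g(1)] st] st unfolding q_def
    by (metis atLeastatMost_subset_iff)
  have "\<exists>n. \<not> ((\<lambda>u. q u * p u ^ n) has_integral 0) {s..t}"
  proof (rule peak_integral_nonzero[OF _ _ qc qx _ _ B])
    show "isCont p x"
      using continuous_on_interior[OF continuous_tails[OF p]] regular_interior[OF xr] by simp
    show "p x = 1" using h by (simp add: p_def)
    show "0 \<le> p u" "p u \<le> 1" if "u \<in> {s..t}" for u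
      using M(1) M(2)[OF that] h(3) by (auto simp: p_def)
    show "0 \<le> q u * q x" if "\<bar>u - x\<bar> < d" for u
      using d0(2)[of u] that d by (auto simp: dist_real_def abs_if zero_le_mult_iff split: if_splits)
    show "p u \<le> 1 - h v0 / M" if "u \<in> {s..t}" "d \<le> \<bar>u - x\<bar>" for u
    proof -
      have "u \<in> K" using that by (auto simp: K_def abs_if split: if_splits)
      then show ?thesis using v0 M by (auto simp: p_def divide_right_mono)
    qed
    show "0 < 1 - h v0 / M" "1 - h v0 / M < 1" using M h(4)[OF v0(1)] by auto
  qed (use x in auto)
  moreover have "((\<lambda>u. q u * p u ^ n) has_integral 0) {s..t}" for n
    using tails_annihilated[OF int0 tails_power[OF p, of n] st, where k = k] by (simp add: q_def mult_ac)
  ultimately show False by blast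
qed

end

section \<open>Folded paths as tree-like excursions\<close>

text \<open>The outgoing path is \<open>X\<close> on \<open>{x..z}\<close>, rescaled to the unit
  interval. The way back visits the same points at its own speed, which \<rho> translates into the
  change of parameter \<phi>.\<close>

lemma tree_like_excursion_fold:
  fixes X :: "real \<Rightarrow> 'a::topological_space"
  assumes xzy: "x < z" "z < y" and X: "continuous_on {x..z} X"
    and \<rho>: "continuous_on {z..y} \<rho>" "\<And>u v. z \<le> u \<Longrightarrow> u < v \<Longrightarrow> v \<le> y \<Longrightarrow> \<rho> v < \<rho> u"
    and ends: "\<rho> z = z" "\<rho> y = x"
    and fold: "\<And>u. u \<in> {z..y} \<Longrightarrow> X u = X (\<rho> u)"
  shows "tree_like_excursion x y X"
proof -
  define Y where "Y v = X (x + v * (z - x))" for v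
  define L where "L v = (v - x) / (z - x)" for v
  \<comment> \<open>On its second half the joined path at parameter v is
    \<open>Y (2 - 2 * v)\<close>, hence the formula after \<open>z\<close>. It increases because
    \<rho> decreases, and both formulas give 1/2 at \<open>z\<close>.\<close>
  define \<phi> where "\<phi> u = (if u \<le> z then L u / 2 else 1 - L (\<rho> u) / 2)" for u
  have \<rho>_range: "x \<le> \<rho> u" "\<rho> u \<le> z" "z < u \<Longrightarrow> \<rho> u < z" if "u \<in> {z..y}" for u
    using \<rho>(2)[of u y] \<rho>(2)[of z u] ends that xzy by (cases "u = y"; cases "u = z"; force)+
  have left: "\<phi> u \<le> 1/2" "Y (2 * \<phi> u) = X u" if "u \<in> {x..z}" for u
  proof -
    have eq: "2 * \<phi> u = L u" using that by (simp add: \<phi>_def)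
    have "L u \<le> 1" using that xzy by (simp add: L_def)
    then show "\<phi> u \<le> 1/2" using eq by simp
    show "Y (2 * \<phi> u) = X u" using xzy by (simp add: eq Y_def L_def)
  qed
  have right: "1/2 < \<phi> u" "Y (2 - 2 * \<phi> u) = X u" if "u \<in> {z<..y}" for u
  proof -
    have eq: "2 - 2 * \<phi> u = L (\<rho> u)" using that by (simp add: \<phi>_def)
    have "L (\<rho> u) < 1" using that xzy \<rho>_range[of u] by (simp add: L_def)
    then show "1/2 < \<phi> u" using eq by simp
    show "Y (2 - 2 * \<phi> u) = X u" using xzy that fold[of u] by (simp add: eq Y_def L_def)
  qed
  have "x \<le> x + v * (z - x) \<and> x + v * (z - x) \<le> z" if "0 \<le> v" "v \<le> 1" for v
  proof -
    have "0 \<le> v * (z - x)" "v * (z - x) \<le> z - x"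
      using that xzy mult_left_le_one_le[of "z - x" v] by auto
    then show ?thesis by linarith
  qed
  then have "path Y"
    unfolding path_def Y_def
    by (intro continuous_on_compose2[OF X] continuous_intros) auto
  moreover have "continuous_on {x..y} \<phi>"
  proof -
    have "{x..y} = {x..z} \<union> {z..y}" using xzy by auto
    then show ?thesis
      unfolding \<phi>_def L_def
      using xzy \<rho>(1) ends
      by (auto intro!: continuous_on_cases continuous_intros simp: field_simps)
  qed
  moreover have "strict_mono_on {x..y} \<phi>"
  proof (rule strict_mono_onI)
    fix u v assume uv: "u \<in> {x..y}" "v \<in> {x..y}" "u < v"
    consider "v \<le> z" | "u \<le> z" "z < v" | "z < u" by linarith
    then show "\<phi> u < \<phi> v"
    proof cases
      case 1
      then show ?thesis using uv xzy by (auto simp: \<phi>_def L_def divide_strict_right_mono)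
    next
      case 2
      then have "\<phi> u \<le> 1/2" "1/2 < \<phi> v"
        using left(1)[of u] right(1)[of v] uv by auto
      then show ?thesis by linarith
    next
      case 3
      then show ?thesis using uv xzy \<rho>(2)[of u v] by (auto simp: \<phi>_def L_def divide_strict_right_mono)
    qed
  qed
  moreover have "\<phi> x = 0" "\<phi> y = 1"
    using xzy ends by (auto simp: \<phi>_def L_def)
  moreover have "X u = (Y +++ reversepath Y) (\<phi> u)" if "u \<in> {x..y}" for u
    using left[of u] right[of u] that xzy
    by (cases "u \<le> z") (auto simp: joinpaths_def reversepath_def)
  ultimately show ?thesis
    unfolding tree_like_excursion_def by blast
qed

section \<open>Separation of times on reduced paths\<close>

locale regular_path = piecewise_C1_path +
  assumes regular: "\<And>u. u \<in> {a..b} - F \<Longrightarrow> D u \<noteq> 0"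
begin

definition indist_pair :: "real \<Rightarrow> real \<Rightarrow> real \<Rightarrow> real \<Rightarrow> bool" where
  "indist_pair s t x y \<longleftrightarrow> s \<le> x \<and> x < y \<and> y \<le> t \<and> indist x y"

lemma indist_inside:
  assumes "indist_pair a b s t" "x \<in> {s<..<t} - F"
  shows "\<exists>v\<in>{s..t}. v \<noteq> x \<and> indist x v"
proof (rule exists_indist[of s t x "\<lambda>_. 1"])
  have st: "a \<le> s" "s < t" "t \<le> b" "\<And>w. tail w s = tail w t"
    using assms by (auto simp: indist_pair_def indist_def)
  then show "a \<le> s" "t \<le> b" "D x \<noteq> 0"
    using assms(2) by (auto intro!: regular)
  show "((\<lambda>u. 1 * tail w u * D u $ k) has_integral 0) {s..t}" for w k
    using tail_diff[of s t w k] st(1-3) st(4)[of "k # w"] by simp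
qed (use assms(2) in auto)

text \<open>Some coordinate of \<open>X\<close> has nonvanishing derivative near a regular time, so
  by Rolle's theorem it takes no value twice there, whereas indistinguishable times share the value
  of \<open>X\<close>.\<close>

lemma locally_distinguished:
  assumes z: "z \<in> {a..b} - F"
  obtains e where "e > 0" "\<And>u v. \<bar>u - z\<bar> < e \<Longrightarrow> \<bar>v - z\<bar> < e \<Longrightarrow> u < v \<Longrightarrow> \<not> indist u v"
proof -
  obtain k where k: "D z $ k \<noteq> 0"
    using regular[OF z] by (auto simp: vec_eq_iff)
  have "isCont (\<lambda>u. D u $ k) z"
    by (intro continuous_intros continuous_at_D z)
  then have "((\<lambda>u. D u $ k) \<longlongrightarrow> D z $ k) (nhds z)"
    using tendsto_at_iff_tendsto_nhds[of "\<lambda>u. D u $ k" z] by (simp add: isCont_def)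
  then have "eventually (\<lambda>u. D u $ k \<noteq> 0) (nhds z)"
    by (rule tendsto_imp_eventually_ne[OF _ k])
  moreover have "eventually (\<lambda>u. u \<in> {a..b} - F) (nhds z)"
    using open_regular z by (auto simp: eventually_nhds)
  ultimately have "eventually (\<lambda>u. u \<in> {a..b} - F \<and> D u $ k \<noteq> 0) (nhds z)"
    by eventually_elim auto
  then obtain e where e: "e > 0" "\<And>u. dist u z < e \<Longrightarrow> u \<in> {a..b} - F \<and> D u $ k \<noteq> 0"
    unfolding eventually_nhds_metric by blast
  have "\<not> indist u v" if uv: "\<bar>u - z\<bar> < e" "\<bar>v - z\<bar> < e" "u < v" for u v
  proof
    assume "indist u v"
    have near: "x \<in> {a..b} - F \<and> D x $ k \<noteq> 0" if "u \<le> x" "x \<le> v" for x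
      using e(2)[of x] uv that by (auto simp: dist_real_def)
    have "\<exists>x>u. x < v \<and> ((\<lambda>u. X u $ k) has_real_derivative 0) (at x)"
    proof (rule Rolle[OF uv(3)])
      show "X u $ k = X v $ k"
        using indist_imp_eq[OF _ _ \<open>indist u v\<close>] near[of u] near[of v] uv by auto
      show "continuous_on {u..v} (\<lambda>u. X u $ k)"
        using near by (intro continuous_intros continuous_on_subset[OF continuous_X]) auto
      show "\<And>x. u < x \<Longrightarrow> x < v \<Longrightarrow> (\<lambda>u. X u $ k) differentiable at x"
        using deriv_X_nth near real_differentiable_def by (meson less_imp_le)
    qed
    then obtain x where x: "u < x" "x < v" "((\<lambda>u. X u $ k) has_real_derivative 0) (at x)"
      by blast
    then show False
      using DERIV_unique[OF x(3) deriv_X_nth] near[of x] by auto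
  qed
  with e(1) show ?thesis using that by blast
qed

text \<open>Serves both to find a shortest pair and to show that the folding map has a closed
  graph.\<close>

lemma compact_indist:
  assumes "{s..t} \<subseteq> {a..b}" "{s'..t'} \<subseteq> {a..b}"
  shows "compact {p \<in> {s..t} \<times> {s'..t'}. indist (fst p) (snd p)}"
proof -
  let ?S = "{s..t} \<times> {s'..t'}"
  have "compact (?S \<inter> (\<Inter>w. {p \<in> ?S. tail w (fst p) - tail w (snd p) = 0}))"
  proof (intro compact_Int_closed closed_INT ballI continuous_closed_preimage_constant)
    show "continuous_on ?S (\<lambda>p. tail w (fst p) - tail w (snd p))" for w
      using assms
      by (intro continuous_on_diff continuous_on_compose2[OF continuous_tail] continuous_intros) auto
  qed (auto intro: compact_Times closed_Times)
  also have "?S \<inter> (\<Inter>w. {p \<in> ?S. tail w (fst p) - tail w (snd p) = 0}) =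
      {p \<in> ?S. indist (fst p) (snd p)}"
    by (auto simp: indist_def)
  finally show ?thesis .
qed

text \<open>Otherwise compactness would provide a shortest pair. A regular time strictly inside it
  has a partner in the same interval, and these two form a strictly shorter pair.\<close>

lemma short_indist_pair:
  assumes st: "indist_pair a b s t" and "e > 0"
  obtains x y where "indist_pair s t x y" "y - x < e"
proof (rule ccontr)
  assume "\<not> thesis"
  then have long: "e \<le> y - x" if "indist_pair s t x y" for x y
    using that \<open>\<And>x y. indist_pair s t x y \<Longrightarrow> y - x < e \<Longrightarrow> thesis\<close> by force
  \<comment> \<open>The closed condition on the length keeps \<open>P\<close> away from the
    diagonal, where indistinguishability is trivial.\<close>
  define P where "P = {p \<in> {s..t} \<times> {s..t}. indist (fst p) (snd p)} \<inter> {p. e \<le> snd p - fst p}"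
  have s: "a \<le> s" "s < t" "t \<le> b" "indist s t"
    using st by (auto simp: indist_pair_def)
  have P_iff: "(x, y) \<in> P \<longleftrightarrow> indist_pair s t x y" for x y
    using long[of x y] \<open>e > 0\<close> by (auto simp: P_def indist_pair_def)
  have "compact P"
    unfolding P_def using s
    by (intro compact_Int_closed compact_indist closed_Collect_le continuous_intros) auto
  moreover have "P \<noteq> {}"
    using s P_iff[of s t] by (auto simp: indist_pair_def)
  moreover have "continuous_on P (\<lambda>p. snd p - fst p)"
    by (intro continuous_intros)
  ultimately obtain p where p: "p \<in> P" "\<And>q. q \<in> P \<Longrightarrow> snd p - fst p \<le> snd q - fst q"
    using continuous_attains_inf[of P "\<lambda>p. snd p - fst p"] by metis
  obtain x y where xy: "p = (x, y)" by fastforce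
  have pair: "indist_pair s t x y" "\<And>x' y'. indist_pair s t x' y' \<Longrightarrow> y - x \<le> y' - x'"
    using p P_iff[of x y] p(2)[of "(_, _)"] by (auto simp: xy P_iff)
  have "x < y" using pair by (auto simp: indist_pair_def)
  then have "infinite ({x<..<y} - F)"
    using finite_F by (simp add: infinite_Ioo Diff_infinite_finite)
  then obtain u where u: "u \<in> {x<..<y} - F"
    by (metis finite.emptyI ex_in_conv)
  have "indist_pair a b x y"
    using pair(1) s by (auto simp: indist_pair_def)
  then obtain v where v: "v \<in> {x..y}" "v \<noteq> u" "indist u v"
    using indist_inside u by blast
  have "indist_pair s t (min u v) (max u v)"
    using u v pair(1) by (auto simp: indist_pair_def min_def max_def intro: indist_sym)
  from pair(2)[OF this] show False
    using u v by (auto simp: min_def max_def split: if_splits)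
qed

text \<open>The left ends of ever shorter pairs have a limit point. It is irregular because
  \<open>locally_distinguished\<close> excludes pairs close to a regular time.\<close>

lemma indist_pairs_accumulate:
  assumes st: "indist_pair a b s t"
  obtains z where "z \<in> F \<inter> {s..t}"
    "\<And>e. e > 0 \<Longrightarrow> \<exists>x y. indist_pair s t x y \<and> \<bar>x - z\<bar> < e \<and> \<bar>y - z\<bar> < e"
proof -
  have "\<exists>x y. indist_pair s t x y \<and> y - x < inverse (real (Suc n))" for n
    using short_indist_pair[OF st, of "inverse (real (Suc n))"] by (metis inverse_positive_iff_positive of_nat_0_less_iff zero_less_Suc)
  then obtain x y where xy: "\<And>n. indist_pair s t (x n) (y n)" "\<And>n. y n - x n < inverse (real (Suc n))"
    by metis
  have "\<forall>n. x n \<in> {s..t}"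
    using xy(1) by (auto simp: indist_pair_def intro: less_imp_le order_trans)
  then obtain z r where z: "z \<in> {s..t}" "strict_mono r" "(x \<circ> r) \<longlonglongrightarrow> z"
    using compact_Icc[of s t] unfolding compact_def by blast
  have acc: "\<exists>x y. indist_pair s t x y \<and> \<bar>x - z\<bar> < e \<and> \<bar>y - z\<bar> < e" if "e > 0" for e
  proof -
    have "eventually (\<lambda>n. dist ((x \<circ> r) n) z < e / 2) sequentially"
      using z(3) \<open>e > 0\<close> tendstoD half_gt_zero by blast
    moreover have "eventually (\<lambda>n. inverse (real (Suc n)) < e / 2) sequentially"
      using order_tendstoD(2)[OF LIMSEQ_inverse_real_of_nat, of "e / 2"] \<open>e > 0\<close> by simp
    ultimately have "eventually (\<lambda>n. dist ((x \<circ> r) n) z < e / 2 \<and> inverse (real (Suc n)) < e / 2) sequentially"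
      by eventually_elim auto
    then obtain n where n: "dist (x (r n)) z < e / 2" "inverse (real (Suc n)) < e / 2"
      by (auto dest!: eventually_happens)
    have "inverse (real (Suc (r n))) \<le> inverse (real (Suc n))"
      using seq_suble[OF z(2), of n] by (intro le_imp_inverse_le) auto
    moreover have "x (r n) < y (r n)"
      using xy(1)[of "r n"] by (auto simp: indist_pair_def)
    ultimately have "\<bar>y (r n) - z\<bar> < e" "\<bar>x (r n) - z\<bar> < e"
      using n xy(2)[of "r n"] unfolding dist_real_def by linarith+
    then show ?thesis using xy(1) by blast
  qed
  have "z \<in> F"
  proof (rule ccontr)
    assume "z \<notin> F"
    then have "z \<in> {a..b} - F"
      using z(1) st by (auto simp: indist_pair_def)
    then obtain e where "e > 0" "\<And>u v. \<bar>u - z\<bar> < e \<Longrightarrow> \<bar>v - z\<bar> < e \<Longrightarrow> u < v \<Longrightarrow> \<not> indist u v"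
      using locally_distinguished by blast
    with acc[of e] show False
      by (auto simp: indist_pair_def)
  qed
  then show ?thesis using that[of z] z(1) acc by blast
qed

text \<open>Every pair inside \<open>{x..y}\<close> has an irregular time in its interval, hence
  encloses \<open>z\<close>. If \<open>z\<close> were an end point, each interior time could only
  have \<open>z\<close> as its partner, and two interior times would form a pair that misses
  \<open>z\<close>.\<close>

lemma indist_pair_straddles:
  assumes xy: "indist_pair a b x y" and F: "{x..y} \<inter> F = {z}"
  shows "x < z \<and> z < y"
proof -
  have z: "x \<le> z" "z \<le> y" using F by auto
  have between: "u \<le> z \<and> z \<le> v" if "indist_pair x y u v" for u v
  proof -
    have "indist_pair a b u v" "{u..v} \<subseteq> {x..y}"
      using that xy by (auto simp: indist_pair_def)
    then show ?thesis
      using indist_pairs_accumulate[of u v] F by (metis IntD1 IntD2 IntI atLeastAtMost_iff singletonD subsetD)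
  qed
  have "z \<noteq> x \<and> z \<noteq> y"
  proof (rule ccontr)
    assume at_end: "\<not> ?thesis"
    have collapse: "indist u z" if u: "u \<in> {x<..<y}" for u
    proof -
      have "u \<in> {x<..<y} - F" using F at_end u by auto
      then obtain v where v: "v \<in> {x..y}" "v \<noteq> u" "indist u v"
        using indist_inside[OF xy] by blast
      then have "indist_pair x y (min u v) (max u v)"
        using u by (auto simp: indist_pair_def min_def max_def intro: indist_sym)
      from between[OF this] have "v = z"
        using u v at_end by (auto simp: min_def max_def split: if_splits)
      then show ?thesis using v by simp
    qed
    define u v where "u = (2 * x + y) / 3" and "v = (x + 2 * y) / 3"
    have uv: "x < u" "u < v" "v < y"
      using xy by (auto simp: u_def v_def indist_pair_def)
    then have "indist u v"
      using collapse[of u] collapse[of v] indist_sym indist_trans by (meson greaterThanLessThan_iff less_trans)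
    then have "indist_pair x y u v"
      using uv by (auto simp: indist_pair_def)
    from between[OF this] show False using uv at_end by auto
  qed
  then show ?thesis using z by auto
qed

text \<open>Each time in \<open>{z..y}\<close> has exactly one partner in \<open>{x..z}\<close>. The
  partner map is continuous and injective and fixes \<open>z\<close>, hence decreasing, so the path
  is folded at \<open>z\<close>.\<close>

lemma excursion_of_indist_pair:
  assumes xy: "indist_pair a b x y" and F: "{x..y} \<inter> F = {z}"
  shows "tree_like_excursion x y X"
proof -
  have ab: "a \<le> x" "x < y" "y \<le> b" "indist x y" using xy by (auto simp: indist_pair_def)
  have z: "x < z" "z < y" using indist_pair_straddles[OF xy F] by auto
  \<comment> \<open>A pair inside \<open>{x..y}\<close> encloses an irregular time, which can only
    be \<open>z\<close>, so the previous lemma applies to that pair too.\<close>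
  have straddle: "u < z \<and> z < v" if "u < v" "x \<le> u" "v \<le> y" "indist u v" for u v
  proof -
    have uv: "indist_pair a b u v" using that ab by (auto simp: indist_pair_def)
    then obtain z' where "z' \<in> F \<inter> {u..v}" by (rule indist_pairs_accumulate)
    then have "{u..v} \<inter> F = {z}" using F that by fastforce
    then show ?thesis by (rule indist_pair_straddles[OF uv])
  qed
  have "\<exists>v\<in>{x..z}. indist u v" if u: "u \<in> {z..y}" for u
  proof -
    consider "u = z" | "u = y" | "u \<noteq> z" "u \<noteq> y" by blast
    then show ?thesis
    proof cases
      case 1
      have "indist z z" "z \<in> {x..z}" using z by (simp_all add: indist_def)
      then show ?thesis unfolding 1 by (rule bexI)
    next
      case 2
      have "x \<in> {x..z}" using z by simp
      with indist_sym[OF ab(4)] show ?thesis unfolding 2 by (rule bexI)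
    next
      case 3
      then have ux: "x < u" "u < y" "z < u" using u z by auto
      have "u \<notin> F"
      proof
        assume "u \<in> F"
        then have "u \<in> {x..y} \<inter> F" using ux by simp
        then show False using F 3 by simp
      qed
      then obtain v where v: "v \<in> {x..y}" "v \<noteq> u" "indist u v"
        using indist_inside[OF xy, of u] ux by auto
      have "v < z"
      proof (cases "u < v")
        case True
        then show ?thesis using straddle[of u v] v ux by simp
      next
        case False
        then show ?thesis using straddle[of v u] v ux indist_sym[OF v(3)] by simp
      qed
      then show ?thesis using v by (intro bexI[of _ v]) simp_all
    qed
  qed
  then obtain \<rho> where \<rho>: "\<And>u. u \<in> {z..y} \<Longrightarrow> \<rho> u \<in> {x..z}" "\<And>u. u \<in> {z..y} \<Longrightarrow> indist u (\<rho> u)"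
    by metis
  \<comment> \<open>Two distinct indistinguishable times would lie strictly on opposite sides of
    \<open>z\<close>.\<close>
  have uniq: "v = v'" if "{v, v'} \<subseteq> {x..z} \<or> {v, v'} \<subseteq> {z..y}" "indist v v'" for v v'
    using straddle[of v v'] straddle[of v' v] that z indist_sym[OF that(2)]
    by (cases v v' rule: linorder_cases) auto
  have \<rho>_eq: "\<rho> u = v" if "u \<in> {z..y}" "v \<in> {x..z}" "indist u v" for u v
    using uniq[of "\<rho> u" v] indist_trans[OF indist_sym[OF \<rho>(2)[OF that(1)]] that(3)] \<rho>(1)[OF that(1)] that(2)
    by blast
  have inj: "inj_on \<rho> {z..y}"
  proof (rule inj_onI)
    fix u v assume uv: "u \<in> {z..y}" "v \<in> {z..y}" "\<rho> u = \<rho> v"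
    then have "indist u v"
      using \<rho>(2)[of u] \<rho>(2)[of v] indist_sym indist_trans by metis
    then show "u = v" using uniq uv by blast
  qed
  have ends: "\<rho> z = z" "\<rho> y = x"
    using \<rho>_eq[of z z] \<rho>_eq[of y x] ab z indist_sym[OF ab(4)] by (auto simp: indist_def)
  \<comment> \<open>By uniqueness the graph of \<rho> is the whole relation, which is compact; a
    closed graph with values in a compact interval gives continuity.\<close>
  have "(\<lambda>u. (u, \<rho> u)) ` {z..y} = {p \<in> {z..y} \<times> {x..z}. indist (fst p) (snd p)}"
    using \<rho> \<rho>_eq by (auto simp: image_iff)
  moreover have "compact {p \<in> {z..y} \<times> {x..z}. indist (fst p) (snd p)}"
    by (rule compact_indist) (use ab z in auto)
  ultimately have "closed ((\<lambda>u. (u, \<rho> u)) ` {z..y})"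
    by (simp add: compact_imp_closed)
  then have cont: "continuous_on {z..y} \<rho>"
    using \<rho>(1) by (intro continuous_from_closed_graph[of "{x..z}"]) auto
  have decr: "\<rho> v < \<rho> u" if "z \<le> u" "u < v" "v \<le> y" for u v
  proof (cases "u = z")
    case True
    then show ?thesis
      using that \<rho>(1)[of v] ends inj_onD[OF inj, of z v] z by fastforce
  next
    case False
    \<comment> \<open>A continuous injection is monotone on \<open>{z..v}\<close>. The increasing
      case is impossible because \<open>\<rho> z = z\<close> is the largest admissible
      value.\<close>
    have "\<rho> z < \<rho> u \<and> \<rho> u < \<rho> v \<or> \<rho> v < \<rho> u \<and> \<rho> u < \<rho> z"
      using False that cont inj
      by (intro continuous_inj_imp_mono) (auto elim: continuous_on_subset inj_on_subset)
    then show ?thesis using \<rho>(1)[of u] ends that by auto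
  qed
  show ?thesis
  proof (rule tree_like_excursion_fold[OF z _ cont decr ends])
    show "continuous_on {x..z} X"
      using continuous_X by (rule continuous_on_subset) (use ab z in auto)
    show "X u = X (\<rho> u)" if "u \<in> {z..y}" for u
      using \<rho>[OF that] that ab z by (intro indist_imp_eq) auto
  qed auto
qed

text \<open>Pairs accumulate at an irregular time. As \<open>F\<close> is finite, a pair close
  enough to that time meets no other element of \<open>F\<close> and therefore bounds an
  excursion.\<close>

lemma reduced_imp_distinguished:
  assumes "reduced a b X" "s \<in> {a..b}" "t \<in> {a..b}" "indist s t"
  shows "s = t"
proof -
  have False if st: "indist_pair a b s t" for s t
  proof -
    obtain z where z: "z \<in> F"
        "\<And>e. e > 0 \<Longrightarrow> \<exists>x y. indist_pair s t x y \<and> \<bar>x - z\<bar> < e \<and> \<bar>y - z\<bar> < e"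
      using indist_pairs_accumulate[OF st] by blast
    obtain d where d: "d > 0" "\<And>u. u \<in> F \<Longrightarrow> u \<noteq> z \<Longrightarrow> d \<le> dist z u"
      using finite_set_avoid[OF finite_F] by blast
    obtain x y where xy: "indist_pair s t x y" "\<bar>x - z\<bar> < d" "\<bar>y - z\<bar> < d"
      using z(2)[OF d(1)] by blast
    have pair: "indist_pair a b x y"
      using xy(1) st by (auto simp: indist_pair_def)
    have "u = z" if "u \<in> {x..y} \<inter> F" for u
      using d(2)[of u] that xy by (force simp: dist_real_def)
    moreover have "{x..y} \<inter> F \<noteq> {}"
      using indist_pairs_accumulate[OF pair] by blast
    ultimately have "{x..y} \<inter> F = {z}" by blast
    then have "tree_like_excursion x y X"
      by (rule excursion_of_indist_pair[OF pair])
    then show False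
      using assms(1) pair by (auto simp: reduced_def indist_pair_def)
  qed
  from this[of s t] this[of t s] show ?thesis
    using assms indist_sym[OF assms(4)] by (cases s t rule: linorder_cases) (auto simp: indist_pair_def)
qed

end

section \<open>Linear differential equations\<close>

lemma has_vector_derivative_vec:
  fixes f :: "real \<Rightarrow> real^'n"
  assumes "\<And>i. ((\<lambda>t. f t $ i) has_real_derivative f' $ i) (at x within S)"
  shows "(f has_vector_derivative f') (at x within S)"
  using assms
  unfolding has_real_derivative_iff_has_vector_derivative has_vector_derivative_def
  by (subst has_derivative_componentwise_within)
     (auto simp: Basis_vec_def inner_axis)

text \<open>The exponential series of the matrix applied to \<open>p\<close>, taken coordinate by
  coordinate so that real power series can be differentiated termwise.\<close>

lemma linear_flow_exists:
  fixes A :: "real^'r^'r" and p :: "real^'r"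
  obtains E where "E 0 = p" "\<And>\<theta>. (E has_vector_derivative A *v E \<theta>) (at \<theta>)"
proof -
  define q where "q n = (((*v) A) ^^ n) p" for n
  define K where "K = onorm ((*v) A)"
  have K0: "0 \<le> K" unfolding K_def by (intro onorm_pos_le) auto
  have nq: "norm (q n) \<le> K ^ n * norm p" for n
  proof (induction n)
    case (Suc n)
    have "norm (q (Suc n)) \<le> K * norm (q n)"
      unfolding q_def K_def by (simp add: onorm)
    also have "\<dots> \<le> K * (K ^ n * norm p)"
      by (rule mult_left_mono[OF Suc K0])
    finally show ?case by (simp add: mult_ac)
  qed (simp add: q_def)
  define c where "c i n = q n $ i / fact n" for i n
  have sm: "summable (\<lambda>n. c i n * \<theta> ^ n)" for i \<theta>
  proof (rule summable_comparison_test)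
    show "summable (\<lambda>n. norm p * (inverse (fact n) * (K * \<bar>\<theta>\<bar>) ^ n))"
      by (intro summable_mult summable_exp)
    have "norm (c i n * \<theta> ^ n) \<le> norm p * (inverse (fact n) * (K * \<bar>\<theta>\<bar>) ^ n)" for n
    proof -
      have "\<bar>q n $ i\<bar> \<le> K ^ n * norm p"
        using component_le_norm_cart[of "q n" i] nq[of n] by linarith
      then have "\<bar>q n $ i\<bar> * (\<bar>\<theta>\<bar> ^ n / fact n) \<le> K ^ n * norm p * (\<bar>\<theta>\<bar> ^ n / fact n)"
        by (rule mult_right_mono) simp
      then show ?thesis
        by (simp add: c_def abs_mult power_abs power_mult_distrib divide_inverse mult_ac)
    qed
    then show "\<exists>N. \<forall>n\<ge>N. norm (c i n * \<theta> ^ n) \<le> norm p * (inverse (fact n) * (K * \<bar>\<theta>\<bar>) ^ n)"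
      by blast
  qed
  define E where "E \<theta> = (\<chi> i. \<Sum>n. c i n * \<theta> ^ n)" for \<theta>
  have "E 0 $ i = p $ i" for i
    unfolding E_def by (simp only: vec_lambda_beta powser_zero) (simp add: c_def q_def)
  then have "E 0 = p" by (simp add: vec_eq_iff)
  moreover have "(E has_vector_derivative A *v E \<theta>) (at \<theta>)" for \<theta>
  proof (rule has_vector_derivative_vec)
    fix i
    \<comment> \<open>Differentiation shifts the coefficients: (n+1) / (n+1)! = 1 / n!, and
      \<open>q (Suc n)\<close> is \<open>A *v q n\<close>.\<close>
    have "(\<Sum>n. diffs (c i) n * \<theta> ^ n) = (\<Sum>n. \<Sum>j\<in>UNIV. A $ i $ j * (c j n * \<theta> ^ n))"
      by (intro suminf_cong)
         (simp add: diffs_def c_def q_def matrix_vector_mult_def sum_distrib_left sum_distrib_right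
           sum_divide_distrib mult_ac del: of_nat_Suc)
    also have "\<dots> = (\<Sum>j\<in>UNIV. A $ i $ j * (\<Sum>n. c j n * \<theta> ^ n))"
      by (simp add: suminf_sum suminf_mult summable_mult sm)
    also have "\<dots> = (A *v E \<theta>) $ i"
      by (simp add: E_def matrix_vector_mult_def)
    finally show "((\<lambda>t. E t $ i) has_real_derivative (A *v E \<theta>) $ i) (at \<theta>)"
      using termdiffs_strong_converges_everywhere[OF sm, of i \<theta>] by (simp add: E_def)
  qed
  ultimately show ?thesis using that by blast
qed

text \<open>Gronwall's argument for \<open>\<bar>e\<bar>\<^sup>2\<close>, run forwards and backwards from the zero \<open>x\<close> of \<open>e\<close>.\<close>

lemma linear_ode_unique:
  fixes e :: "real \<Rightarrow> real^'r" and A :: "real^'r^'r"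
  assumes F: "finite F" and e: "continuous_on {a..b} e"
    and deriv: "\<And>u. u \<in> {a<..<b} - F \<Longrightarrow> (e has_vector_derivative \<sigma> u *\<^sub>R (A *v e u)) (at u)"
    and C: "\<And>u. u \<in> {a..b} \<Longrightarrow> \<bar>\<sigma> u\<bar> \<le> C"
    and x: "x \<in> {a..b}" "e x = 0" and u: "u \<in> {a..b}"
  shows "e u = 0"
proof -
  define N where "N u = e u \<bullet> e u" for u
  define N' where "N' u = 2 * \<sigma> u * (e u \<bullet> (A *v e u))" for u
  define K where "K = 2 * C * onorm ((*v) A)"
  have N'_le: "\<bar>N' u\<bar> \<le> K * N u" if "u \<in> {a..b}" for u
  proof -
    have "\<bar>e u \<bullet> (A *v e u)\<bar> \<le> norm (e u) * norm (A *v e u)"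
      by (rule Cauchy_Schwarz_ineq2)
    also have "\<dots> \<le> norm (e u) * (onorm ((*v) A) * norm (e u))"
      by (intro mult_left_mono onorm) auto
    finally have "\<bar>e u \<bullet> (A *v e u)\<bar> \<le> onorm ((*v) A) * N u"
      by (simp add: N_def dot_square_norm power2_eq_square mult_ac)
    then have "\<bar>\<sigma> u\<bar> * \<bar>e u \<bullet> (A *v e u)\<bar> \<le> C * (onorm ((*v) A) * N u)"
      using C[OF that] by (intro mult_mono) auto
    then show ?thesis by (simp add: N'_def K_def abs_mult)
  qed
  have dN: "(N has_real_derivative N' u) (at u)" if "u \<in> {a<..<b} - F" for u
    unfolding N_def[abs_def] N'_def has_real_derivative_iff_has_vector_derivative has_vector_derivative_def
    by (rule has_derivative_eq_rhs,
        rule has_derivative_inner[OF deriv[OF that, unfolded has_vector_derivative_def]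
          deriv[OF that, unfolded has_vector_derivative_def]])
       (simp add: fun_eq_iff inner_commute algebra_simps)
  have cN: "continuous_on {a..b} N"
    unfolding N_def[abs_def] by (intro continuous_intros e)
  have N0: "N x = 0" using x by (simp add: N_def)
  \<comment> \<open>Integrating factor: since \<open>\<bar>N' u\<bar> \<le> K * N u\<close>, the
    choice \<open>k = - K\<close> makes the integrand nonpositive and \<open>k = K\<close> makes it
    nonnegative.\<close>
  have int: "((\<lambda>u. exp (k * u) * (N' u + k * N u)) has_integral exp (k * t) * N t - exp (k * s) * N s) {s..t}"
    if "a \<le> s" "s \<le> t" "t \<le> b" for k s t
  proof (rule fundamental_theorem_of_calculus_interior_strong[OF F that(2)])
    show "continuous_on {s..t} (\<lambda>u. exp (k * u) * N u)"
      using that by (intro continuous_intros continuous_on_subset[OF cN]) auto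
    fix u assume "u \<in> {s<..<t} - F"
    then have "(N has_real_derivative N' u) (at u)" using dN that by auto
    then have "((\<lambda>u. exp (k * u) * N u) has_real_derivative exp (k * u) * (N' u + k * N u)) (at u)"
      by (auto intro!: derivative_eq_intros simp: algebra_simps)
    then show "((\<lambda>u. exp (k * u) * N u) has_vector_derivative exp (k * u) * (N' u + k * N u)) (at u)"
      by (simp add: has_real_derivative_iff_has_vector_derivative)
  qed
  have "N u \<le> 0"
  proof (cases "x \<le> u")
    case True
    have "exp (- K * u) * N u - exp (- K * x) * N x \<le> 0"
    proof (rule has_integral_le[OF int[of x u "- K"] has_integral_0])
      show "exp (- K * v) * (N' v + - K * N v) \<le> 0" if "v \<in> {x..u}" for v
        using N'_le[of v] that x u by (auto simp: mult_le_0_iff)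
    qed (use True x u in auto)
    then show ?thesis using N0 by (simp add: mult_le_0_iff)
  next
    case False
    have "0 \<le> exp (K * x) * N x - exp (K * u) * N u"
    proof (rule has_integral_nonneg[OF int[of u x K]])
      show "0 \<le> exp (K * v) * (N' v + K * N v)" if "v \<in> {u..x}" for v
        using N'_le[of v] that x u by (auto simp: zero_le_mult_iff)
    qed (use False x u in auto)
    then show ?thesis using N0 by (simp add: zero_le_mult_iff mult_le_0_iff)
  qed
  then have "e u \<bullet> e u = 0"
    using inner_ge_zero[of "e u"] unfolding N_def by (rule antisym)
  then show ?thesis by simp
qed

lemma continuous_zero_off_finite:
  fixes g :: "real \<Rightarrow> real"
  assumes "a < b" "finite F" "continuous_on {a..b} g" "\<And>x. x \<in> {a..b} - F \<Longrightarrow> g x = 0"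
    and u: "u \<in> {a..b}"
  shows "g u = 0"
proof (rule ccontr)
  assume gu: "g u \<noteq> 0"
  obtain d where d: "d > 0" "\<And>x. x \<in> {a..b} \<Longrightarrow> dist x u < d \<Longrightarrow> dist (g x) (g u) < \<bar>g u\<bar>"
    using assms(3) u gu unfolding continuous_on_iff by (metis zero_less_abs_iff)
  define l r where "l = max a (u - d)" and "r = min b (u + d)"
  have "l < r" using d u assms(1) by (auto simp: l_def r_def)
  then have "infinite ({l<..<r} - F)"
    using assms(2) by (simp add: infinite_Ioo Diff_infinite_finite)
  then obtain x where x: "x \<in> {l<..<r} - F"
    by (metis finite.emptyI ex_in_conv)
  then have "g x = 0" "dist (g x) (g u) < \<bar>g u\<bar>"
    using assms(4)[of x] d(2)[of x] by (auto simp: l_def r_def dist_real_def abs_less_iff)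
  then show False by simp
qed

section \<open>Paths with time, value and derivative coordinates\<close>

lemma triple_nth [simp]:
  "triple x y z $ Inl c = x" "triple x y z $ lval j = y $ j" "triple x y z $ lder i = z $ i"
  by (simp_all add: triple_def)

lemma triple_index:
  fixes k :: "1 + 'r + 'r"
  obtains "k = ltime" | j where "k = lval j" | i where "k = lder i"
  by (metis num1_eq1 sum.exhaust)

lemma has_vector_derivative_triple:
  assumes "(x has_real_derivative x') (at t within S)"
    "(y has_vector_derivative y') (at t within S)" "(z has_vector_derivative z') (at t within S)"
  shows "((\<lambda>t. triple (x t) (y t) (z t)) has_vector_derivative triple x' y' z') (at t within S)"
proof (rule has_vector_derivative_vec)
  fix k :: "1 + 'a + 'a"
  show "((\<lambda>t. triple (x t) (y t) (z t) $ k) has_real_derivative triple x' y' z' $ k) (at t within S)"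
    using assms bounded_linear.has_vector_derivative[OF bounded_linear_vec_nth]
    by (cases k rule: triple_index) (auto simp: has_real_derivative_iff_has_vector_derivative)
qed

lemma continuous_on_triple:
  assumes "continuous_on S x" "continuous_on S y" "continuous_on S z"
  shows "continuous_on S (\<lambda>t. triple (x t) (y t) (z t))"
proof -
  have "continuous_on S (\<lambda>t. triple (x t) (y t) (z t) $ k)" for k
    using assms by (cases k rule: triple_index) (auto intro: continuous_intros)
  then have "continuous_on S (\<lambda>t. \<chi> k. triple (x t) (y t) (z t) $ k)"
    by (rule continuous_on_vec_lambda)
  then show ?thesis by simp
qed

text \<open>Allows stationary times to be declared irregular.\<close>

lemma (in piecewise_C1_path) superset:
  assumes "finite F'" "F \<subseteq> F'"
  shows "piecewise_C1_path a b X F'"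
  using assms less ends_F continuous_X deriv_X bounded_D continuous_on_subset[OF continuous_D, of "{a..b} - F'"]
  unfolding D_def by unfold_locales auto

text \<open>The break points serve as irregular times. The derivative of each piece is continuous up
  to the ends of that piece, hence bounded, and the break points add only finitely many
  values.\<close>

lemma C1_pw_imp_piecewise_C1_path:
  assumes "C1_pw a b X" "a < b"
  shows "\<exists>F. piecewise_C1_path a b X F"
proof -
  define D where "D s = vector_derivative X (at s within {a..b})" for s
  obtain n t where X: "continuous_on {a..b} X" and t: "t 0 = a" "t n = b"
      "\<And>i. i < n \<Longrightarrow> t i < t (Suc i)" "\<And>i. i < n \<Longrightarrow> C1_on_interval (t i) (t (Suc i)) X"
    using assms(1) unfolding C1_pw_def by blast
  obtain d where d: "\<And>i u. i < n \<Longrightarrow> u \<in> {t i..t (Suc i)} \<Longrightarrow>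
        (X has_vector_derivative d i u) (at u within {t i..t (Suc i)})"
      "\<And>i. i < n \<Longrightarrow> continuous_on {t i..t (Suc i)} (d i)"
    using t(4) unfolding C1_on_interval_def by metis
  have lower: "a \<le> t i" if "i \<le> n" for i
    using that
  proof (induction i)
    case (Suc i)
    then show ?case using t(3)[of i] by auto
  qed (simp add: t)
  have upper: "t i \<le> b" if "i \<le> n" for i
    using that
  proof (induction rule: inc_induct)
    case (step i)
    then show ?case using t(3)[of i] by auto
  qed (simp add: t)
  have piece: "\<exists>i<m. t i < u \<and> u < t (Suc i)" if "m \<le> n" "u \<in> {a..t m} - t ` {..m}" for m u
    using that
  proof (induction m)
    case (Suc m)
    show ?case
    proof (cases "u \<le> t m")
      case True
      then have "u \<in> {a..t m} - t ` {..m}" using Suc.prems by auto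
      then show ?thesis using Suc by (metis Suc_leD less_SucI)
    next
      case False
      have "u \<noteq> t (Suc m)" using Suc.prems by auto
      then show ?thesis using False Suc.prems by (intro exI[of _ m]) auto
    qed
  qed (use t in auto)
  let ?F = "t ` {..n}"
  have at: "(X has_vector_derivative d i u) (at u)" "D u = d i u"
    if "i < n" "t i < u" "u < t (Suc i)" for i u
  proof -
    show *: "(X has_vector_derivative d i u) (at u)"
      using d(1)[of i u] that by (simp add: at_within_Icc_at)
    have "a < u" "u < b" using lower[of i] upper[of "Suc i"] that by auto
    then show "D u = d i u"
      using vector_derivative_at[OF *] by (simp add: D_def at_within_Icc_at)
  qed
  have "piecewise_C1_path a b X ?F"
  proof (unfold_locales; (fold D_def)?)
    show "a < b" "finite ?F" "continuous_on {a..b} X" by (use assms X in auto)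
    show "a \<in> ?F" "b \<in> ?F" using t(1,2) by force+
    show "(X has_vector_derivative D u) (at u)" if "u \<in> {a..b} - ?F" for u
      using piece[of n u] that t(2) at by (metis order_refl)
    show "continuous_on ({a..b} - ?F) D"
    proof (intro continuous_at_imp_continuous_on ballI)
      fix u assume "u \<in> {a..b} - ?F"
      then obtain i where i: "i < n" "t i < u" "u < t (Suc i)"
        using piece[of n u] t(2) by auto
      have "continuous_on {t i<..<t (Suc i)} (d i)"
        by (rule continuous_on_subset[OF d(2)[OF i(1)]]) auto
      then have "continuous_on {t i<..<t (Suc i)} D"
        by (subst continuous_on_cong[OF refl at(2)[OF i(1)]]) auto
      then show "isCont D u"
        using i by (simp add: continuous_on_eq_continuous_at)
    qed
    have "D ` {a..b} \<subseteq> (\<Union>i<n. d i ` {t i..t (Suc i)}) \<union> D ` ?F"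
    proof (rule image_subsetI)
      fix u assume u: "u \<in> {a..b}"
      show "D u \<in> (\<Union>i<n. d i ` {t i..t (Suc i)}) \<union> D ` ?F"
      proof (cases "u \<in> ?F")
        case False
        then obtain i where i: "i < n" "t i < u" "u < t (Suc i)"
          using piece[of n u] t(2) u by auto
        then have "D u \<in> d i ` {t i..t (Suc i)}"
          using at(2)[OF i] by auto
        then show ?thesis using i by blast
      qed blast
    qed
    moreover have "bounded (\<Union>i<n. d i ` {t i..t (Suc i)})"
      using d(2) by (intro bounded_UN ballI compact_imp_bounded compact_continuous_image) auto
    then have "bounded ((\<Union>i<n. d i ` {t i..t (Suc i)}) \<union> D ` ?F)"
      by (simp add: finite_imp_bounded)
    ultimately show "bounded (D ` {a..b})" using bounded_subset by blast
  qed
  then show ?thesis by blast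
qed

section \<open>From integral curves to the signature identities\<close>

text \<open>The linear relation between the coordinates holds at every time, hence for their
  increments, and each further integration preserves it by linearity.\<close>

lemma signature_condition_of_integral_curve:
  fixes A :: "real^'r^'r"
  assumes ab: "a \<le> 0" "0 < b" and f: "integral_curve A {a..b} f" "f 0 = p"
    and X: "\<And>t. t \<in> {a..b} \<Longrightarrow> X t = triple t (f t) (vector_derivative f (at t within {a..b}))"
  shows "signature_condition A p a b X"
proof -
  have less: "a < b" using ab by linarith
  have df: "(f has_vector_derivative A *v f t) (at t within {a..b})" if "t \<in> {a..b}" for t
    using f that by (simp add: integral_curve_def)
  have Xt: "X t = triple t (f t) (A *v f t)" if "t \<in> {a..b}" for t
    using X[OF that] vector_derivative_within_closed_interval[OF less that df[OF that]] by simp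
  define D where "D t = triple 1 (A *v f t) (A *v (A *v f t))" for t
  have dX: "(X has_vector_derivative D t) (at t within {a..b})" if "t \<in> {a..b}" for t
  proof (rule has_vector_derivative_transform[OF that Xt])
    show "((\<lambda>t. triple t (f t) (A *v f t)) has_vector_derivative D t) (at t within {a..b})"
      unfolding D_def
      by (intro has_vector_derivative_triple df that derivative_intros
          bounded_linear.has_vector_derivative[OF matrix_vector_mul_bounded_linear])
  qed
  have D: "vector_derivative X (at t within {a..b}) = D t" if "t \<in> {a..b}" for t
    by (rule vector_derivative_within_closed_interval[OF less that dX[OF that]])
  have cf: "continuous_on {a..b} f"
    using df by (meson continuous_on_vector_derivative)
  have cD: "continuous_on {a..b} D"
    unfolding D_def
    by (intro continuous_on_triple continuous_intros cf
        bounded_linear.continuous_on[OF matrix_vector_mul_bounded_linear])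
  interpret piecewise_C1_path a b X "{a, b}" "\<lambda>s. vector_derivative X (at s within {a..b})"
  proof unfold_locales
    show "continuous_on {a..b} X"
      using dX by (meson continuous_on_vector_derivative)
    show "(X has_vector_derivative vector_derivative X (at u within {a..b})) (at u)"
      if "u \<in> {a..b} - {a, b}" for u
      using dX[of u] D[of u] that by (auto simp: at_within_Icc_at less_le)
    show "continuous_on ({a..b} - {a, b}) (\<lambda>s. vector_derivative X (at s within {a..b}))"
      using continuous_on_subset[OF cD, of "{a..b} - {a, b}"]
      by (subst continuous_on_cong[OF refl D]) auto
    have "(\<lambda>s. vector_derivative X (at s within {a..b})) ` {a..b} = D ` {a..b}"
      using D by auto
    then show "bounded ((\<lambda>s. vector_derivative X (at s within {a..b})) ` {a..b})"
      using compact_imp_bounded[OF compact_continuous_image[OF cD]] by simp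
  qed (use less in auto)
  \<comment> \<open>\<open>iter_int\<close> reads reversed words, so the letter being replaced, the
    first of the word and the innermost integral, stands at the end of the list. Induction on
    \<open>v\<close> adds outer integrals.\<close>
  have iter: "(\<Sum>j\<in>UNIV. A $ i $ j * iter_int a b X (v @ [lval j]) t) = iter_int a b X (v @ [lder i]) t"
    if "t \<in> {a..b}" for i v t
    using that
  proof (induction v arbitrary: t)
    case Nil
    then show ?case
      using less unfolding append_Nil
      by (simp add: iter_int_letter Xt matrix_vector_mult_def right_diff_distrib sum_subtractf
          del: iter_int.simps)
  next
    case (Cons k v)
    let ?D = "\<lambda>s. vector_derivative X (at s within {a..b}) $ k"
    have "(\<Sum>j\<in>UNIV. A $ i $ j * iter_int a b X ((k # v) @ [lval j]) t) =
        (\<Sum>j\<in>UNIV. integral {a..t} (\<lambda>s. A $ i $ j * (iter_int a b X (v @ [lval j]) s * ?D s)))"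
      by simp
    also have "\<dots> = integral {a..t} (\<lambda>s. \<Sum>j\<in>UNIV. A $ i $ j * (iter_int a b X (v @ [lval j]) s * ?D s))"
      using Cons.prems
      by (intro integral_sum[symmetric] integrable_on_mult_right integrable_weighted
          continuous_on_subset[OF continuous_iter_int]) auto
    also have "\<dots> = integral {a..t} (\<lambda>s. iter_int a b X (v @ [lder i]) s * ?D s)"
      using Cons by (intro integral_cong) (auto simp: sum_distrib_left sum_distrib_right mult_ac simp flip: Cons.IH)
    finally show ?case by simp
  qed
  have "X 0 = triple 0 p (A *v p)"
    using Xt[of 0] ab f by simp
  then show ?thesis
    unfolding signature_condition_def sig_def using iter[of b] less by simp
qed

section \<open>From the signature identities to integral curves\<close>

text \<open>If \<open>X\<close> moves along a curve parametrised by \<open>\<tau>\<close>, then so does every \<open>tail w\<close>, hence a return of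
  \<open>\<tau>\<close> to an earlier value is invisible to the signature.\<close>

lemma (in piecewise_C1_path) tail_factors:
  fixes V :: "real \<Rightarrow> real^'d" and \<tau> \<sigma> :: "real \<Rightarrow> real"
  assumes \<tau>: "continuous_on {a..b} \<tau>" "\<And>u. u \<in> {a..b} - F \<Longrightarrow> (\<tau> has_real_derivative \<sigma> u) (at u)"
    and V: "continuous_on UNIV V" "\<And>u. u \<in> {a..b} - F \<Longrightarrow> D u = \<sigma> u *\<^sub>R V (\<tau> u)"
    and st: "s \<in> {a..b}" "t \<in> {a..b}" "\<tau> s = \<tau> t"
  shows "indist s t"
proof -
  have "bounded (\<tau> ` {a..b})"
    using \<tau>(1) by (intro compact_imp_bounded compact_continuous_image) auto
  then obtain B where B: "\<And>u. u \<in> {a..b} \<Longrightarrow> \<bar>\<tau> u\<bar> \<le> B"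
    unfolding bounded_iff by (metis imageI real_norm_def)
  \<comment> \<open>The margin 1 keeps all values of \<tau> in the open interval, where
    antiderivatives have two-sided derivatives.\<close>
  define c where "c = B + 1"
  have \<tau>c: "\<tau> u \<in> {-c<..<c}" if "u \<in> {a..b}" for u
    using B[OF that] by (auto simp: c_def)
  have "\<exists>C. continuous_on {-c..c} C \<and> (\<forall>u\<in>{a..b}. tail w u = C (\<tau> u))" for w
  proof (induction w)
    case Nil
    then show ?case by (intro exI[of _ "\<lambda>_. 1"]) auto
  next
    case (Cons k w)
    then obtain C where C: "continuous_on {-c..c} C" "\<And>u. u \<in> {a..b} \<Longrightarrow> tail w u = C (\<tau> u)"
      by blast
    define h where "h \<theta> = C \<theta> * V \<theta> $ k" for \<theta>
    have h: "continuous_on {-c..c} h"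
      unfolding h_def by (intro continuous_intros C(1) continuous_on_subset[OF V(1)]) auto
    \<comment> \<open>Composing an antiderivative with \<tau> performs the substitution by the chain
      rule, even where \<tau> turns back.\<close>
    define P where "P \<theta> = integral {-c..\<theta>} h" for \<theta>
    have cP: "continuous_on {-c..c} P"
      unfolding P_def by (intro indefinite_integral_continuous_1 integrable_continuous_interval h)
    have dP: "(P has_real_derivative h \<theta>) (at \<theta>)" if "\<theta> \<in> {-c<..<c}" for \<theta>
      using integral_has_real_derivative[OF h, of \<theta>] that
      by (simp add: P_def[abs_def] at_within_Icc_at)
    have "tail (k # w) u = P (\<tau> b) - P (\<tau> u)" if u: "u \<in> {a..b}" for u
    proof -
      have "((\<lambda>v. h (\<tau> v) * \<sigma> v) has_integral P (\<tau> b) - P (\<tau> u)) {u..b}"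
      proof (rule has_integral_deriv)
        have "continuous_on {u..b} \<tau>"
          by (rule continuous_on_subset[OF \<tau>(1)]) (use u in auto)
        then show "continuous_on {u..b} (\<lambda>v. P (\<tau> v))"
          by (rule continuous_on_compose2[OF cP])
             (use u \<tau>c in \<open>fastforce simp: less_imp_le\<close>)
        fix v assume "v \<in> {u<..<b} - F"
        then have v: "v \<in> {a..b} - F" using u by auto
        then show "((\<lambda>v. P (\<tau> v)) has_real_derivative h (\<tau> v) * \<sigma> v) (at v)"
          by (intro DERIV_chain2[OF dP \<tau>(2)] \<tau>c) auto
      qed (use u in auto)
      moreover have "integral {u..b} (\<lambda>v. tail w v * D v $ k) = integral {u..b} (\<lambda>v. h (\<tau> v) * \<sigma> v)"
        using u C(2) V(2)
        by (intro integral_spike[OF negligible_finite[OF finite_F]]) (auto simp: h_def)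
      ultimately show ?thesis by (simp add: integral_unique)
    qed
    moreover have "continuous_on {-c..c} (\<lambda>\<theta>. P (\<tau> b) - P \<theta>)"
      by (intro continuous_intros cP)
    ultimately show ?case by blast
  qed
  then show ?thesis
    unfolding indist_def using st by metis
qed

lemma reduced_holonomic_factors_through_flow:
  fixes A :: "real^'r^'r" and X :: "real \<Rightarrow> real^(1 + 'r + 'r)"
  assumes ab: "a \<le> 0" "0 < b" and red: "reduced a b X" and hol: "holonomic a b X"
    and sg: "signature_condition A p a b X"
    and crit: "finite {t\<in>{a..b}. (X has_vector_derivative 0) (at t within {a..b})}"
  defines "\<tau> \<equiv> \<lambda>t. X t $ ltime"
  obtains E where "\<And>\<theta>. (E has_vector_derivative A *v E \<theta>) (at \<theta>)"
    "\<And>u. u \<in> {a..b} \<Longrightarrow> (\<chi> j. X u $ lval j) = E (\<tau> u)" "inj_on \<tau> {a..b}"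
proof -
  have less: "a < b" and zero: "0 \<in> {a..b}" using ab by auto
  define D where "D s = vector_derivative X (at s within {a..b})" for s
  define f where "f t = (\<chi> j. X t $ lval j)" for t
  obtain F0 where "piecewise_C1_path a b X F0"
    using C1_pw_imp_piecewise_C1_path[OF _ less] hol unfolding holonomic_def by blast
  then interpret P0: piecewise_C1_path a b X F0 D
    by (simp_all add: D_def[abs_def])
  \<comment> \<open>With the stationary times added to \<open>F\<close>, the velocity is nonzero at
    every regular time, as \<open>regular_path\<close> demands.\<close>
  define F where "F = F0 \<union> {t\<in>{a..b}. (X has_vector_derivative 0) (at t within {a..b})}"
  have "piecewise_C1_path a b X F"
    by (rule P0.superset) (use crit P0.finite_F in \<open>auto simp: F_def\<close>)
  then interpret piecewise_C1_path a b X F D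
    by (simp_all add: D_def[abs_def])
  have within: "(X has_vector_derivative D u) (at u within {a..b})" if "u \<in> {a..b} - F" for u
    by (rule has_vector_derivative_at_within[OF deriv_X[OF that]])
  have "D u \<noteq> 0" if u: "u \<in> {a..b} - F" for u
    using within[OF u] u by (auto simp: F_def)
  then interpret regular_path a b X F D
    by unfold_locales (simp_all add: D_def)
  \<comment> \<open>An increment of the defect rather than the defect itself, because a first letter
    integrates to an increment from \<open>a\<close>.\<close>
  define g where "g i u = (\<Sum>j\<in>UNIV. A $ i $ j * (X u $ lval j - X a $ lval j)) - (X u $ lder i - X a $ lder i)" for i u
  have cX: "continuous_on {a..b} (\<lambda>u. X u $ k)" for k
    by (intro continuous_intros continuous_X)
  have cg: "continuous_on {a..b} (g i)" for i
    unfolding g_def by (intro continuous_intros cX)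
  have int_g: "((\<lambda>u. g i u * tail w u * D u $ k) has_integral 0) {a..b}" for i w k
  proof -
    have I: "((\<lambda>u. (X u $ l - X a $ l) * tail w u * D u $ k) has_integral sig a b X (l # k # w)) {a..b}" for l
      unfolding sig_eq_integral
      by (intro integrable_integral integrable_weighted continuous_intros cX continuous_tail) auto
    have "((\<lambda>u. (\<Sum>j\<in>UNIV. A $ i $ j * ((X u $ lval j - X a $ lval j) * tail w u * D u $ k))
          - (X u $ lder i - X a $ lder i) * tail w u * D u $ k)
        has_integral (\<Sum>j\<in>UNIV. A $ i $ j * sig a b X (lval j # k # w)) - sig a b X (lder i # k # w)) {a..b}"
      by (intro has_integral_diff has_integral_sum has_integral_mult_right I) auto
    moreover have "(\<Sum>j\<in>UNIV. A $ i $ j * sig a b X (lval j # k # w)) - sig a b X (lder i # k # w) = 0"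
      using sg by (simp add: signature_condition_def)
    ultimately show ?thesis
      by (simp add: g_def left_diff_distrib sum_distrib_right mult.assoc)
  qed
  have "g i u = 0" if u: "u \<in> {a..b} - F" for i u
  proof (rule ccontr)
    assume "g i u \<noteq> 0"
    then obtain v where "v \<in> {a..b}" "v \<noteq> u" "indist u v"
      using exists_indist[OF order_refl order_refl _ regular[OF u] cg _ int_g, of i] u regular_interior[OF u]
      by auto
    then show False
      using reduced_imp_distinguished[OF red, of u v] u by auto
  qed
  then have g0: "g i u = 0" if "u \<in> {a..b}" for i u
    using continuous_zero_off_finite[OF less finite_F cg _ that] by blast
  have X0: "X 0 = triple 0 p (A *v p)"
    using sg by (simp add: signature_condition_def)
  \<comment> \<open>The vanishing of \<open>g\<close> only makes the defect constant; the prescribed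
    value \<open>X 0\<close> makes that constant zero.\<close>
  have lder: "X u $ lder i = (\<Sum>j\<in>UNIV. A $ i $ j * X u $ lval j)" if "u \<in> {a..b}" for u i
    using g0[OF that, of i] g0[OF zero, of i] X0
    by (simp add: g_def right_diff_distrib sum_subtractf matrix_vector_mult_def)
  have lder_f: "X u $ lder i = (A *v f u) $ i" if "u \<in> {a..b}" for u i
    by (simp add: lder[OF that] f_def matrix_vector_mult_def)
  define \<sigma> where "\<sigma> u = D u $ ltime" for u
  have D_lval: "D u $ lval i = \<sigma> u * (A *v f u) $ i" if u: "u \<in> {a..b} - F" for u i
  proof -
    have "D u $ lval i = \<sigma> u * X u $ lder i"
      using hol within[OF u] u unfolding holonomic_def \<sigma>_def by blast
    then show ?thesis using lder_f[of u i] u by simp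
  qed
  have D_lder: "D u $ lder i = \<sigma> u * (A *v (A *v f u)) $ i" if u: "u \<in> {a..b} - F" for u i
  proof -
    have "((\<lambda>u. \<Sum>j\<in>UNIV. A $ i $ j * X u $ lval j) has_real_derivative
        (\<Sum>j\<in>UNIV. A $ i $ j * D u $ lval j)) (at u)"
      \<comment> \<open>The derivative coordinates are linear in the value coordinates on an open
        set of times, so their velocities obey the same relation.\<close>
      by (intro DERIV_sum DERIV_cmult deriv_X_nth u)
    then have "((\<lambda>u. X u $ lder i) has_real_derivative (\<Sum>j\<in>UNIV. A $ i $ j * D u $ lval j)) (at u)"
      by (rule has_field_derivative_transform_within_open[OF _ open_regular u]) (simp add: lder)
    then have "D u $ lder i = (\<Sum>j\<in>UNIV. A $ i $ j * D u $ lval j)"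
      using DERIV_unique deriv_X_nth[OF u] by blast
    then show ?thesis
      by (simp add: D_lval[OF u] matrix_vector_mult_def[of A "A *v f u"] sum_distrib_left mult_ac)
  qed
  obtain E where E: "E 0 = p" "\<And>\<theta>. (E has_vector_derivative A *v E \<theta>) (at \<theta>)"
    using linear_flow_exists by blast
  have cE: "continuous_on S E" for S
    using E(2) has_vector_derivative_continuous continuous_at_imp_continuous_on by blast
  have \<tau>: "continuous_on {a..b} \<tau>" "\<And>u. u \<in> {a..b} - F \<Longrightarrow> (\<tau> has_real_derivative \<sigma> u) (at u)"
    unfolding \<tau>_def \<sigma>_def by (auto intro: cX deriv_X_nth)
  have fE: "f u = E (\<tau> u)" if u: "u \<in> {a..b}" for u
  proof -
    obtain C where C: "\<And>u. u \<in> {a..b} \<Longrightarrow> \<bar>1 * D u $ ltime\<bar> \<le> C"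
      using bounded_weighted[OF continuous_on_const order_refl order_refl] by metis
    \<comment> \<open>The difference solves e' = \<sigma> A e at regular times and vanishes at time
      0, because \<open>\<tau> 0 = 0\<close> and \<open>E 0 = p\<close>.\<close>
    have "f u - E (\<tau> u) = 0"
    proof (rule linear_ode_unique[where e = "\<lambda>u. f u - E (\<tau> u)" and \<sigma> = \<sigma> and C = C and A = A, OF finite_F])
      show "continuous_on {a..b} (\<lambda>u. f u - E (\<tau> u))"
        unfolding f_def
        by (intro continuous_intros continuous_on_compose2[OF cE[of UNIV] \<tau>(1)] continuous_X) auto
      fix v assume "v \<in> {a<..<b} - F"
      then have v: "v \<in> {a..b} - F" by auto
      have df: "(f has_vector_derivative \<sigma> v *\<^sub>R (A *v f v)) (at v)"
        using deriv_X_nth[OF v]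
        by (intro has_vector_derivative_vec) (simp flip: D_lval[OF v], simp add: f_def)
      have dE: "((E \<circ> \<tau>) has_vector_derivative \<sigma> v *\<^sub>R (A *v E (\<tau> v))) (at v)"
        using \<tau>(2)[OF v] E(2)
        by (intro vector_diff_chain_at) (simp_all add: has_real_derivative_iff_has_vector_derivative)
      show "((\<lambda>u. f u - E (\<tau> u)) has_vector_derivative
          \<sigma> v *\<^sub>R (A *v (f v - E (\<tau> v)))) (at v)"
        using has_vector_derivative_diff[OF df dE]
        by (simp add: o_def matrix_vector_mult_diff_distrib scaleR_diff_right)
    next
      show "f 0 - E (\<tau> 0) = 0"
        using X0 E(1) by (simp add: f_def \<tau>_def vec_eq_iff)
      show "\<bar>\<sigma> v\<bar> \<le> C" if "v \<in> {a..b}" for v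
        using C[OF that] by (simp add: \<sigma>_def)
    qed (use zero u in auto)
    then show ?thesis by simp
  qed
  \<comment> \<open>\<open>V\<close> is the velocity of the curve (\<theta>, E(\<theta>), A
    E(\<theta>)) along which \<open>X\<close> moves with speed factor \<sigma>.\<close>
  define V where "V \<theta> = triple 1 (A *v E \<theta>) (A *v (A *v E \<theta>))" for \<theta>
  have V: "continuous_on UNIV V"
    unfolding V_def
    by (intro continuous_on_triple continuous_intros cE
        bounded_linear.continuous_on[OF matrix_vector_mul_bounded_linear])
  have D_V: "D u = \<sigma> u *\<^sub>R V (\<tau> u)" if u: "u \<in> {a..b} - F" for u
  proof -
    have "D u $ k = (\<sigma> u *\<^sub>R V (\<tau> u)) $ k" for k
      using D_lval[OF u] D_lder[OF u] fE[of u] u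
      by (cases k rule: triple_index) (auto simp: V_def \<sigma>_def)
    then show ?thesis by (simp add: vec_eq_iff)
  qed
  have "inj_on \<tau> {a..b}"
    using tail_factors[OF \<tau> V D_V] reduced_imp_distinguished[OF red] by (intro inj_onI) blast
  with E(2) fE show ?thesis
    using that unfolding f_def by blast
qed

text \<open>Increasing changes of parameter do not alter the signature, so the identities can
  describe \<open>f\<close> only as a function of the time coordinate \<tau>. The converse therefore
  concerns \<open>f\<close> itself when \<tau> is the identity, and \<open>f\<close> after the
  inverse of \<tau> when the stationary times are finite in number and can join the irregular
  ones.\<close>

theorem corollary6p4:
  fixes A :: "real^'r^'r" and p :: "real^'r" and a b :: real
  assumes "a \<le> 0" and "0 < b"
  shows
    "(\<forall>(f :: real \<Rightarrow> real^'r) X.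
        integral_curve A {a..b} f \<and> f 0 = p \<and>
        (\<forall>t\<in>{a..b}. X t = triple t (f t) (vector_derivative f (at t within {a..b})))
        \<longrightarrow> signature_condition A p a b X)
     \<and>
     (\<forall>(X :: real \<Rightarrow> real^(1 + 'r + 'r)) (f :: real \<Rightarrow> real^'r) (\<tau> :: real \<Rightarrow> real).
        reduced a b X \<and> holonomic a b X \<and> signature_condition A p a b X \<and>
        (\<forall>t. f t = (\<chi> j. X t $ lval j)) \<and> (\<forall>t. \<tau> t = X t $ ltime)
        \<longrightarrow>
        ((\<forall>t\<in>{a..b}. \<tau> t = t) \<longrightarrow> integral_curve A {a..b} f) \<and>
        (finite {t\<in>{a..b}. (X has_vector_derivative 0) (at t within {a..b})} \<longrightarrow>
           inj_on \<tau> {a..b} \<and>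
           integral_curve A (\<tau> ` {a..b}) (f \<circ> inv_into {a..b} \<tau>)))"
proof (intro conjI allI impI; (elim conjE)?)
  show "signature_condition A p a b X"
    if "integral_curve A {a..b} f" "f 0 = p"
      "\<forall>t\<in>{a..b}. X t = triple t (f t) (vector_derivative f (at t within {a..b}))" for f X
    using signature_condition_of_integral_curve[OF assms] that by blast
next
  fix X :: "real \<Rightarrow> real^(1 + 'r + 'r)" and f :: "real \<Rightarrow> real^'r" and \<tau> :: "real \<Rightarrow> real"
  assume X: "reduced a b X" "holonomic a b X" "signature_condition A p a b X"
    and f: "\<forall>t. f t = (\<chi> j. X t $ lval j)" and \<tau>: "\<forall>t. \<tau> t = X t $ ltime"
  let ?crit = "{t\<in>{a..b}. (X has_vector_derivative 0) (at t within {a..b})}"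
  have \<tau>_eq: "\<tau> = (\<lambda>t. X t $ ltime)" using \<tau> by auto
  have main: "inj_on \<tau> {a..b} \<and> (\<exists>E. (\<forall>\<theta> S. (E has_vector_derivative A *v E \<theta>) (at \<theta> within S)) \<and>
      (\<forall>u\<in>{a..b}. f u = E (\<tau> u)))" if "finite ?crit"
    using reduced_holonomic_factors_through_flow[OF assms X that]
    unfolding \<tau>_eq f[rule_format] by (metis has_vector_derivative_at_within)
  show "inj_on \<tau> {a..b}" if "finite ?crit"
    using main[OF that] by blast
  show "integral_curve A (\<tau> ` {a..b}) (f \<circ> inv_into {a..b} \<tau>)" if crit: "finite ?crit"
  proof -
    obtain E where E: "\<And>\<theta> S. (E has_vector_derivative A *v E \<theta>) (at \<theta> within S)"
        "\<And>u. u \<in> {a..b} \<Longrightarrow> f u = E (\<tau> u)"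
      using main[OF crit] by blast
    \<comment> \<open>Undoing \<tau> turns \<open>f\<close> into the flow line \<open>E\<close>,
      restricted to the values of \<tau>.\<close>
    have eq: "(f \<circ> inv_into {a..b} \<tau>) \<theta> = E \<theta>" if "\<theta> \<in> \<tau> ` {a..b}" for \<theta>
      using E(2)[OF inv_into_into[OF that]] f_inv_into_f[OF that] by simp
    show ?thesis
      unfolding integral_curve_def
      using has_vector_derivative_transform[OF _ eq E(1)] eq by metis
  qed
  show "integral_curve A {a..b} f" if id: "\<forall>t\<in>{a..b}. \<tau> t = t"
  proof -
    have less: "a < b" using assms by linarith
    \<comment> \<open>The time coordinate has derivative 1 throughout, so the path is never
      stationary and the general case applies.\<close>
    have "?crit = {}"
    proof -
      have False if t: "t \<in> {a..b}" "(X has_vector_derivative 0) (at t within {a..b})" for t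
      proof -
        have "(\<tau> has_vector_derivative 0) (at t within {a..b})"
          using bounded_linear.has_vector_derivative[OF bounded_linear_vec_nth t(2), of ltime]
          by (simp add: \<tau>_eq)
        moreover have "(\<tau> has_vector_derivative 1) (at t within {a..b})"
          by (rule has_vector_derivative_transform[OF t(1) _ has_vector_derivative_id]) (use id in auto)
        ultimately show False
          using vector_derivative_within_closed_interval[OF less t(1), of \<tau>] by (metis zero_neq_one)
      qed
      then show ?thesis by blast
    qed
    then obtain E where E: "\<And>\<theta> S. (E has_vector_derivative A *v E \<theta>) (at \<theta> within S)"
        "\<And>u. u \<in> {a..b} \<Longrightarrow> f u = E (\<tau> u)"
      using main by (metis finite.emptyI)
    have eq: "f u = E u" if "u \<in> {a..b}" for u
      using E(2)[OF that] id that by simp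
    show ?thesis
      unfolding integral_curve_def
      using has_vector_derivative_transform[OF _ eq E(1)] eq by metis
  qed
qed

end
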